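(* Let $a,b,c,d,f,g,h,\rho$ be complex numbers with $\max\{|a|,|b|,|c|,|d|,|f|,|h|\}<1$ and $cd\rho\neq0$. Then $$\frac{1}{2\pi}\int_{-\pi}^{\pi}\frac{\left(\frac{\rho e^{i\theta}}{d},\frac{qde^{-i\theta}}{\rho},\rho ce^{-i\theta},\frac{qe^{i\theta}}{c\rho},abcdfe^{i\theta},ghe^{i\theta};q\right)_\infty}{(ae^{i\theta},be^{i\theta},fe^{i\theta},he^{i\theta},ce^{-i\theta},de^{-i\theta};q)_\infty}\;{}_{3}\phi_2\left[\begin{array}{c}g,\ ae^{i\theta},\ fe^{i\theta}\\ ghe^{i\theta},\ abcdfe^{i\theta}\end{array};q,bcdh\right]d\theta$$ $$=\frac{\left(abcd,\frac{\rho c}{d},\frac{dq}{\rho c},\rho,\frac{q}{\rho},bcdf,acdf,cgh;q\right)_\infty}{(q,ac,ad,bc,bd,cf,ch,df;q)_\infty}\;{}_{3}\phi_2\left[\begin{array}{c}g,\ ac,\ cf\\ cgh,\ acdf\end{array};q,dh\right].$$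
   Context: Let $|q|<1$. The $q$-shifted factorials are $(x;q)_\infty=\prod_{k=0}^{\infty}(1-xq^k)$ and $(x;q)_n=(x;q)_\infty/(xq^n;q)_\infty$, with $(x_1,\ldots,x_m;q)_n=(x_1;q)_n\cdots(x_m;q)_n$ for $n$ an integer or $\infty$. The basic hypergeometric series ${}_3\phi_2$ is ${}_{3}\phi_2\left[\begin{array}{c}a_1,a_2,a_3\\ b_1,b_2\end{array};q,z\right]=\sum_{k=0}^\infty\frac{(a_1,a_2,a_3;q)_k}{(q,b_1,b_2;q)_k}z^k$. As is standard for basic hypergeometric series, parameters are assumed to be such that no denominator vanishes. *)

theory Defs
  imports "HOL-Analysis.Analysis"
begin

definition qpoch_inf :: "complex \<Rightarrow> complex \<Rightarrow> complex" where
  "qpoch_inf x q = (\<Prod>k. 1 - x * q ^ k)"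

text \<open>
  For \<open>n \<ge> 0\<close> the quotient \<open>(x;q)\<^sub>\<infinity> / (x q\<^sup>n;q)\<^sub>\<infinity>\<close> is the finite product below.  The product is
  taken as the definition because the quotient would read \<open>0 / 0 = 0\<close> at terminating parameters
  such as \<open>x = 1 / q\<^sup>m\<close> with \<open>n \<le> m\<close>; see \<open>qpoch_eq_quotient\<close> for the agreement elsewhere.
\<close>

definition qpoch :: "complex \<Rightarrow> complex \<Rightarrow> nat \<Rightarrow> complex" where
  "qpoch x q n = (\<Prod>k<n. 1 - x * q ^ k)"

definition qpochs_inf :: "complex list \<Rightarrow> complex \<Rightarrow> complex" where
  "qpochs_inf xs q = (\<Prod>x\<leftarrow>xs. qpoch_inf x q)"

definition qpochs :: "complex list \<Rightarrow> complex \<Rightarrow> nat \<Rightarrow> complex" where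
  "qpochs xs q n = (\<Prod>x\<leftarrow>xs. qpoch x q n)"

definition phi32 ::
    "complex \<Rightarrow> complex \<Rightarrow> complex \<Rightarrow> complex \<Rightarrow> complex \<Rightarrow> complex \<Rightarrow> complex \<Rightarrow> complex" where
  "phi32 a1 a2 a3 b1 b2 q z =
     (\<Sum>k. qpochs [a1, a2, a3] q k / qpochs [q, b1, b2] q k * z ^ k)"

lemma convergent_prod_qpoch_inf:
  fixes x q :: complex
  assumes "norm q < 1"
  shows "convergent_prod (\<lambda>k. 1 - x * q ^ k)"
proof -
  have "norm (1 - x * q ^ k - 1) = norm x * norm q ^ k" for k
    by (simp add: norm_mult norm_power)
  moreover have "summable (\<lambda>k. norm x * norm q ^ k)"
    using assms by (intro summable_mult summable_geometric) simp
  ultimately have "summable (\<lambda>k. norm (1 - x * q ^ k - 1))"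
    by (simp only:)
  then have "abs_convergent_prod (\<lambda>k. 1 - x * q ^ k)"
    by (simp only: abs_convergent_prod_conv_summable)
  then show ?thesis
    by (rule abs_convergent_prod_imp_convergent_prod)
qed

lemma qpoch_inf_eq_qpoch_mult:
  assumes "norm q < 1"
  shows "qpoch_inf x q = qpoch x q n * qpoch_inf (x * q ^ n) q"
proof (induction n)
  case 0
  then show ?case by (simp add: qpoch_def)
next
  case (Suc n)
  have "(\<lambda>k. 1 - x * q ^ Suc n * q ^ k) has_prod qpoch_inf (x * q ^ Suc n) q"
    unfolding qpoch_inf_def using convergent_prod_qpoch_inf[OF assms]
    by (rule convergent_prod_has_prod)
  then have "(\<lambda>k. 1 - x * q ^ n * q ^ Suc k) has_prod qpoch_inf (x * q ^ Suc n) q"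
    by (simp add: mult_ac)
  from has_prod_Suc_imp[OF this]
  have "qpoch_inf (x * q ^ n) q = qpoch_inf (x * q ^ Suc n) q * (1 - x * q ^ n)"
    by (simp add: qpoch_inf_def has_prod_iff)
  with Suc show ?case
    by (simp add: qpoch_def)
qed

lemma qpoch_eq_quotient:
  assumes q: "norm q < 1" and nz: "\<And>k. x * q ^ n * q ^ k \<noteq> 1"
  shows "qpoch x q n = qpoch_inf x q / qpoch_inf (x * q ^ n) q"
proof -
  have "qpoch_inf (x * q ^ n) q \<noteq> 0"
    unfolding qpoch_inf_def using nz
    by (intro prodinf_nonzero convergent_prod_qpoch_inf q) auto
  then show ?thesis
    by (simp add: qpoch_inf_eq_qpoch_mult[OF q, of x n])
qed

end

theory Submission
  imports Defs
begin

text \<open>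
  Write \<open>P x\<close> for \<open>(x;q)\<^sub>\<infinity>\<close> and \<open>z\<close> for \<open>e\<close> to the power \<open>\<i> \<theta>\<close>, so that the integral is a mean over the
  unit circle.  The parameters \<open>a\<close>, \<open>f\<close> and the pair \<open>g, h\<close> are inserted into a simpler integral, one
  after the other, by the Cauchy operator
  \<open>T(g,h) = \<Sum>\<^sub>n (g;q)\<^sub>n / (q;q)\<^sub>n h\<^sup>n D\<^sup>n\<close>, where \<open>(D F)(x) = (F(x) - F(q x)) / x\<close>.

  The operator has an explicit effect on the products
  \<open>\<phi>(s,t,w;x) = P(x t w) / (P(x s) P(x t))\<close>: by the \<open>q\<close>-Leibniz rule and the \<open>q\<close>-binomial theorem,
  \<open>T(g,h)\<close> with respect to \<open>x\<close> turns \<open>\<phi>(s,t,w;x)\<close> into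
  \<open>P(x t w) P(g h s) / (P(x s) P(x t) P(h s))\<close> times the \<open>\<^sub>3\<phi>\<^sub>2\<close> series with numerator parameters
  \<open>g, x s, w\<close>, denominator parameters \<open>g h s, x t w\<close> and argument \<open>h t\<close>.  After
  division by \<open>P(a b c d)\<close>, and up to factors free of \<open>a\<close>, both sides of the theorem have this shape in
  \<open>x = a\<close>: with \<open>s = z\<close>, \<open>t = b c d\<close>, \<open>w = f z\<close> in the integrand, and with
  \<open>s = c\<close>, \<open>t = d\<close>, \<open>w = c f\<close> on the right.  Each \<open>D\<^sup>n\<close> is a finite combination of dilations of \<open>x\<close>,
  so an evaluation of the mean of \<open>\<phi>(z,t,w(z);x) V(z)\<close> as a multiple of some \<open>\<phi>(s',t',w';x)\<close>, valid for
  all small \<open>x\<close>, may be differenced in \<open>x\<close> and summed; this is the transfer principle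
  \<open>circle_mean_cauchy_kernel\<close>.

  The principle is applied three times to the seed evaluation \<open>circle_mean_seed\<close>, in which
  \<open>b\<close> is the only one of the parameters \<open>a, b, f, g, h\<close>.
  \<^item> \<open>T(\<rho>/(a d), a)\<close> in \<open>x = b\<close> brings in \<open>a\<close>.  The choice \<open>g = \<rho>/(a d)\<close> makes the
    series on the right a \<open>q\<close>-Gauss sum, and it creates the factor \<open>P(\<rho> z/d)\<close>.
  \<^item> \<open>T(0, f)\<close> in \<open>x = a\<close> brings in \<open>f\<close>; with \<open>g = 0\<close> both series are \<open>q\<close>-binomial sums.
  \<^item> \<open>T(g, h)\<close> in \<open>x = a\<close> brings in \<open>g\<close> and \<open>h\<close>, and yields the two \<open>\<^sub>3\<phi>\<^sub>2\<close> series.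

  The seed evaluation is a constant term.  Expanding its three quotients by the \<open>q\<close>-binomial theorem,
  one in powers of \<open>z\<close> and two in powers of \<open>1/z\<close>, leaves a double sum whose inner sum is a \<open>q\<close>-Gauss sum
  and whose outer sum is a \<open>q\<close>-binomial sum.  The \<open>q\<close>-binomial theorem is
  the case \<open>B = 0\<close> of \<open>q_gauss\<close>, which is thus the only summation formula in the argument.
\<close>

section \<open>Means over the unit circle\<close>

definition circle_mean :: "(complex \<Rightarrow> complex) \<Rightarrow> complex" where
  "circle_mean F = 1 / (2 * of_real pi) * integral {-pi..pi} (\<lambda>t. F (cis t))"

lemma circle_mean_cong:
  assumes "\<And>z. norm z = 1 \<Longrightarrow> F z = G z"
  shows "circle_mean F = circle_mean G"
  unfolding circle_mean_def using assms by simp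

lemma circle_mean_cmult: "circle_mean (\<lambda>z. k * F z) = k * circle_mean F"
  by (simp add: circle_mean_def)

lemma continuous_on_cis_sphere:
  assumes "continuous_on (sphere 0 1) F"
  shows "continuous_on S (\<lambda>t. F (cis t))"
  by (rule continuous_on_compose2[OF assms]) (auto intro!: continuous_intros)

lemma circle_mean_diff:
  assumes "continuous_on (sphere 0 1) F" "continuous_on (sphere 0 1) G"
  shows "circle_mean (\<lambda>z. F z - G z) = circle_mean F - circle_mean G"
  unfolding circle_mean_def
  by (subst Henstock_Kurzweil_Integration.integral_diff)
     (auto intro!: integrable_continuous_real continuous_on_cis_sphere assms simp: algebra_simps)

text \<open>
  Term-by-term integration against a fixed continuous weight.  Every expansion below is justified
  through this form of the Weierstrass test.
\<close>

lemma circle_mean_sums: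
  fixes u :: "nat \<Rightarrow> complex \<Rightarrow> complex"
  assumes u: "\<And>n. continuous_on (sphere 0 1) (u n)"
    and M: "\<And>n z. norm z = 1 \<Longrightarrow> norm (u n z) \<le> M n" "summable M"
    and V: "continuous_on (sphere 0 1) V"
  shows "(\<lambda>n. circle_mean (\<lambda>z. u n z * V z)) sums circle_mean (\<lambda>z. (\<Sum>n. u n z) * V z)"
proof -
  have "compact (V ` sphere 0 1)" by (intro compact_continuous_image V) auto
  then obtain C where C: "C > 0" "\<And>z. norm z = 1 \<Longrightarrow> norm (V z) \<le> C"
    by (auto dest!: compact_imp_bounded simp: bounded_pos)
  let ?w = "\<lambda>n t. u n (cis t) * V (cis t)"
  have lim: "uniform_limit {-pi..pi} (\<lambda>N t. \<Sum>n<N. ?w n t) (\<lambda>t. \<Sum>n. ?w n t) sequentially"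
  proof (rule Weierstrass_m_test)
    show "summable (\<lambda>n. M n * C)" using M(2) by (rule summable_mult2)
    show "norm (?w n t) \<le> M n * C" for n t
      unfolding norm_mult using M(1)[of "cis t" n] C(2)[of "cis t"]
      by (intro mult_mono) (auto intro: order_trans[OF norm_ge_zero])
  qed
  have cont: "continuous_on {-pi..pi} (?w n)" for n
    by (intro continuous_intros continuous_on_cis_sphere u V)
  have conts: "continuous_on {-pi..pi} (\<lambda>t. \<Sum>n<N. ?w n t)" for N
    by (intro continuous_on_sum cont)
  obtain I J where IJ:
    "\<And>N. ((\<lambda>t. \<Sum>n<N. ?w n t) has_integral I N) {-pi..pi}"
    "((\<lambda>t. \<Sum>n. ?w n t) has_integral J) {-pi..pi}" "I \<longlonglongrightarrow> J"
    using uniform_limit_integral[OF lim conts sequentially_bot] by blast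
  have "I N = (\<Sum>n<N. integral {-pi..pi} (?w n))" for N
    using integral_unique[OF IJ(1), of N]
    by (subst (asm) integral_sum) (auto intro!: integrable_continuous_real cont)
  then have "I = (\<lambda>N. \<Sum>n<N. integral {-pi..pi} (?w n))" by blast
  then have "(\<lambda>n. integral {-pi..pi} (?w n)) sums J"
    using IJ(3) by (simp add: sums_def)
  moreover have "J = integral {-pi..pi} (\<lambda>t. (\<Sum>n. u n (cis t)) * V (cis t))"
  proof -
    have "summable (\<lambda>n. u n (cis t))" for t
      by (rule summable_comparison_test'[OF M(2), of 0]) (use M(1) in auto)
    then show ?thesis using integral_unique[OF IJ(2)] by (simp add: suminf_mult2)
  qed
  ultimately show ?thesis unfolding circle_mean_def by (intro sums_mult) simp
qed

lemma circle_mean_power_quotient: "circle_mean (\<lambda>z. z ^ n / z ^ m) = (if n = m then 1 else 0)"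
proof -
  have eq: "cis t ^ n / cis t ^ m = exp (\<i> * of_real (real n - real m) * of_real t)" for t
    by (simp add: cis_conv_exp exp_of_nat_mult [symmetric] exp_diff [symmetric] algebra_simps)
  show ?thesis
  proof (cases "n = m")
    case True
    have "integral {-pi..pi} (\<lambda>t. cis t ^ n / cis t ^ m) = integral {-pi..pi} (\<lambda>t::real. 1)"
      using True by (intro integral_cong) simp
    then show ?thesis using True by (simp add: circle_mean_def scaleR_conv_of_real)
  next
    case False
    define k where "k = real n - real m"
    have k: "k \<noteq> 0" using False by (simp add: k_def)
    have "((\<lambda>t. exp (\<i> * of_real k * of_real t)) has_integral
            exp (\<i> * of_real k * of_real pi) / (\<i> * of_real k) -
            exp (\<i> * of_real k * of_real (-pi)) / (\<i> * of_real k)) {-pi..pi}"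
      using k
      by (intro fundamental_theorem_of_calculus)
         (auto intro!: derivative_eq_intros has_vector_derivative_real_field)
    moreover have "exp (\<i> * of_real k * of_real pi) = exp (\<i> * of_real k * of_real (-pi))"
    proof -
      have "exp (\<i> * of_real k * of_real pi) =
          exp (\<i> * of_real k * of_real (-pi) + 2 * of_int (int n - int m) * of_real pi * \<i>)"
        by (simp add: k_def algebra_simps)
      then show ?thesis
        unfolding exp_eq by (intro exI[of _ "int n - int m"]) (simp add: k_def algebra_simps)
    qed
    ultimately have "((\<lambda>t. exp (\<i> * of_real k * of_real t)) has_integral 0) {-pi..pi}"
      by simp
    then show ?thesis using False
      by (simp add: circle_mean_def eq k_def[symmetric] integral_unique del: of_real_diff)
  qed
qed

text \<open>
  The mean extracts a coefficient: absolute convergence allows term-by-term integration, and the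
  powers of \<open>z\<close> are orthonormal on the circle.
\<close>

lemma circle_mean_power_series:
  assumes "summable (\<lambda>n. norm (\<alpha> n))"
  shows "circle_mean (\<lambda>z. (\<Sum>n. \<alpha> n * z ^ n) * (1 / z ^ m)) = \<alpha> m"
proof -
  have "(\<lambda>n. circle_mean (\<lambda>z. \<alpha> n * z ^ n * (1 / z ^ m))) sums
      circle_mean (\<lambda>z. (\<Sum>n. \<alpha> n * z ^ n) * (1 / z ^ m))"
    by (rule circle_mean_sums[where M = "\<lambda>n. norm (\<alpha> n)"])
       (auto simp: norm_mult norm_power assms intro!: continuous_intros)
  moreover have "circle_mean (\<lambda>z. \<alpha> n * z ^ n * (1 / z ^ m)) = (if n = m then \<alpha> m else 0)" for n
    using circle_mean_cmult[of "\<alpha> n" "\<lambda>z. z ^ n / z ^ m"]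
    by (simp add: circle_mean_power_quotient)
  ultimately have "(\<lambda>n. if n = m then \<alpha> n else 0) sums circle_mean (\<lambda>z. (\<Sum>n. \<alpha> n * z ^ n) * (1 / z ^ m))"
    by (simp cong: if_cong)
  then show ?thesis
    using sums_unique2 sums_single by blast
qed

lemma circle_mean_continuous:
  assumes "continuous_on (S \<times> sphere 0 1) (\<lambda>(y, z). F y z)"
  shows "continuous_on S (\<lambda>y. circle_mean (F y))"
proof -
  have "continuous_on (S \<times> cbox (-pi) pi) (\<lambda>(y, t). F y (cis t))"
  proof -
    have "continuous_on (S \<times> cbox (-pi) pi) (\<lambda>p. (\<lambda>(y, z). F y z) (fst p, cis (snd p)))"
      by (rule continuous_on_compose2[OF assms]) (auto intro!: continuous_intros)
    then show ?thesis by (simp add: case_prod_unfold)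
  qed
  from integral_continuous_on_param[OF this] show ?thesis
    unfolding circle_mean_def by (auto intro!: continuous_intros)
qed

lemma circle_mean_negative_series:
  assumes \<beta>: "summable (\<lambda>j. norm (\<beta> j))" "\<And>z. norm z = 1 \<Longrightarrow> (\<lambda>j. \<beta> j * (1 / z) ^ j) sums g z"
    and V: "continuous_on (sphere 0 1) V"
  shows "(\<lambda>j. \<beta> j * circle_mean (\<lambda>z. (1 / z) ^ j * V z)) sums circle_mean (\<lambda>z. g z * V z)"
proof -
  have "(\<lambda>j. circle_mean (\<lambda>z. \<beta> j * (1 / z) ^ j * V z)) sums
      circle_mean (\<lambda>z. (\<Sum>j. \<beta> j * (1 / z) ^ j) * V z)"
    by (rule circle_mean_sums[OF _ _ \<beta>(1) V])
       (auto intro!: continuous_intros simp: norm_mult norm_power norm_divide)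
  moreover have "circle_mean (\<lambda>z. (\<Sum>j. \<beta> j * (1 / z) ^ j) * V z) = circle_mean (\<lambda>z. g z * V z)"
    by (intro circle_mean_cong) (use \<beta>(2) in \<open>auto simp: sums_iff\<close>)
  ultimately show ?thesis by (simp add: mult.assoc circle_mean_cmult)
qed

section \<open>A diagonal rearrangement and a continuity principle\<close>

text \<open>
  The Cauchy product rearrangement for double families that are merely dominated by a product.
  The factor \<open>(g;q)\<^sub>k\<^sub>+\<^sub>l\<close> of the Cauchy operator prevents the terms from being products themselves.
\<close>

lemma triangular_sums:
  fixes F :: "nat \<Rightarrow> nat \<Rightarrow> complex" and u v :: "nat \<Rightarrow> real"
  assumes F: "\<And>k l. norm (F k l) \<le> u k * v l"
    and u: "\<And>k. 0 \<le> u k" "summable u" and v: "\<And>l. 0 \<le> v l" "summable v"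
  shows "(\<lambda>n. \<Sum>k\<le>n. F k (n - k)) sums (\<Sum>k. \<Sum>l. F k l)"
proof -
  have "(\<lambda>(k, l). u k * v l) summable_on UNIV \<times> UNIV"
  proof (rule summable_on_SigmaI[where g = "\<lambda>k. u k * suminf v"])
    show "((\<lambda>l. case (k, l) of (k, l) \<Rightarrow> u k * v l) has_sum u k * suminf v) UNIV" for k
      using u v by (auto intro!: sums_nonneg_imp_has_sum sums_mult summable_sums)
    show "(\<lambda>k. u k * suminf v) summable_on UNIV"
      using u v sums_nonneg_imp_has_sum[OF sums_mult2[OF summable_sums[OF u(2)]], of "suminf v"]
      by (auto simp: summable_on_def suminf_nonneg)
  qed (use u v in auto)
  then have "(\<lambda>p. norm (case p of (k, l) \<Rightarrow> F k l)) summable_on UNIV \<times> UNIV"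
    by (rule Infinite_Sum.abs_summable_on_comparison_test') (use F in auto)
  then have "(\<lambda>(k, l). F k l) summable_on UNIV \<times> UNIV"
    by (rule abs_summable_summable)
  then obtain S where S: "((\<lambda>(k, l). F k l) has_sum S) (UNIV \<times> UNIV)"
    by (auto simp: summable_on_def)
  have row: "((\<lambda>l. F k l) has_sum (\<Sum>l. F k l)) UNIV" for k
  proof -
    have "summable (\<lambda>l. norm (F k l))"
      by (rule summable_comparison_test'[of "\<lambda>l. u k * v l" 0]) (use F v in \<open>auto intro: summable_mult\<close>)
    from norm_summable_imp_has_sum[OF this summable_sums[OF summable_norm_cancel[OF this]]]
    show ?thesis .
  qed
  have "((\<lambda>k. \<Sum>l. F k l) has_sum S) UNIV"
    by (rule has_sum_SigmaD[OF S]) (use row in simp)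
  then have "(\<Sum>k. \<Sum>l. F k l) = S"
    using has_sum_imp_sums sums_unique by blast
  moreover have "((\<lambda>(n, k). F k (n - k)) has_sum S) (SIGMA n:UNIV. {..n})"
    using S
    by (subst has_sum_reindex_bij_witness[of _ "\<lambda>(k, l). (k + l, k)" "\<lambda>(n, k). (k, n - k)"
          "UNIV \<times> UNIV" "\<lambda>(k, l). F k l" _ S S]) auto
  then have "((\<lambda>n. \<Sum>k\<le>n. F k (n - k)) has_sum S) UNIV"
    by (rule has_sum_SigmaD) (auto intro!: has_sum_finiteI)
  ultimately show ?thesis using has_sum_imp_sums by blast
qed

text \<open>
  Differencing in \<open>x\<close> divides by \<open>x\<close>; this principle recovers the value at \<open>x = 0\<close>.
\<close>

lemma eq_at_0_if_eq_nearby: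
  fixes F G :: "complex \<Rightarrow> complex"
  assumes F: "continuous_on (ball 0 1) F" and G: "continuous_on (ball 0 1) G"
    and eq: "\<And>y. y \<noteq> 0 \<Longrightarrow> norm y < 1 \<Longrightarrow> F y = G y"
  shows "F 0 = G 0"
proof -
  have lim: "F \<midarrow>0\<rightarrow> F 0" "G \<midarrow>0\<rightarrow> G 0"
    using F G by (auto simp: continuous_on_eq_continuous_at isCont_def)
  have "\<forall>\<^sub>F y in at 0. F y = G y"
    unfolding eventually_at by (intro exI[of _ 1]) (auto simp: eq)
  then have "G \<midarrow>0\<rightarrow> F 0" using lim(1) by (rule Lim_transform_eventually[rotated])
  then show ?thesis using lim(2) by (rule LIM_unique)
qed

section \<open>Shifted factorials in the unit disc\<close>

locale q_disc =
  fixes q :: complex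
  assumes q: "norm q < 1"
begin

abbreviation P :: "complex \<Rightarrow> complex" where "P x \<equiv> qpoch_inf x q"

lemma qpoch_0 [simp]: "qpoch x q 0 = 1"
  by (simp add: qpoch_def)

lemma qpoch_Suc: "qpoch x q (Suc n) = qpoch x q n * (1 - x * q ^ n)"
  by (simp add: qpoch_def)

lemma qpoch_inf_zero [simp]: "P 0 = 1"
  by (simp add: qpoch_inf_def)

lemma qpoch_zero_left [simp]: "qpoch 0 q n = 1"
  by (simp add: qpoch_def)

lemma qpoch_inf_step: "P x = (1 - x) * P (x * q)"
  using qpoch_inf_eq_qpoch_mult[OF q, of x 1] by (simp add: qpoch_def)

lemma qpoch_inf_shift: "P (x * q ^ n) = (1 - x * q ^ n) * P (x * q ^ Suc n)"
  using qpoch_inf_step[of "x * q ^ n"] by (simp add: mult_ac)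

lemma qpoch_add: "qpoch x q (m + n) = qpoch x q m * qpoch (x * q ^ m) q n"
  by (induction n) (simp_all add: qpoch_Suc power_add mult_ac)

lemma qpoch_LIMSEQ: "(\<lambda>n. qpoch x q n) \<longlonglongrightarrow> P x"
proof -
  have "(\<lambda>n. qpoch x q (Suc n)) \<longlonglongrightarrow> P x"
    using convergent_prod_LIMSEQ[OF convergent_prod_qpoch_inf[OF q]]
    by (simp add: qpoch_def qpoch_inf_def lessThan_Suc_atMost)
  then show ?thesis by (rule LIMSEQ_imp_Suc)
qed

lemma norm_mult_power_less_one:
  assumes "norm x < 1"
  shows "norm (x * q ^ n) < 1"
proof -
  have "norm (x * q ^ n) \<le> norm x * 1"
    unfolding norm_mult norm_power using q by (intro mult_left_mono power_le_one) auto
  with assms show ?thesis by simp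
qed

lemma qpoch_nonzero:
  assumes "norm x < 1"
  shows "qpoch x q n \<noteq> 0"
proof
  assume "qpoch x q n = 0"
  then obtain k where "x * q ^ k = 1" by (auto simp: qpoch_def)
  then show False using norm_mult_power_less_one[OF assms, of k] by simp
qed

lemma qpoch_inf_nonzero:
  assumes "\<And>k. x * q ^ k \<noteq> 1"
  shows "P x \<noteq> 0"
  unfolding qpoch_inf_def using assms
  by (intro prodinf_nonzero convergent_prod_qpoch_inf q) auto

lemma qpoch_inf_nonzero_disc:
  assumes "norm x < 1"
  shows "P x \<noteq> 0"
  using norm_mult_power_less_one[OF assms] by (intro qpoch_inf_nonzero) (metis norm_one less_irrefl)

text \<open>
  From \<open>1 + u \<le> exp u\<close> and the geometric series, a majorant of all finite and infinite products
  with base point of norm at most \<open>R\<close>.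
\<close>

definition qpoch_bound :: "real \<Rightarrow> real" where "qpoch_bound R = exp (R / (1 - norm q))"

lemma qpoch_bound_nonneg [simp]: "0 \<le> qpoch_bound R"
  by (simp add: qpoch_bound_def)

lemma norm_qpoch_le:
  assumes "norm x \<le> R"
  shows "norm (qpoch x q n) \<le> qpoch_bound R"
proof -
  have "norm (qpoch x q n) \<le> (\<Prod>k<n. exp (norm x * norm q ^ k))"
    unfolding qpoch_def
    unfolding prod_norm [symmetric]
  proof (intro prod_mono conjI norm_ge_zero)
    fix k
    have "norm (1 - x * q ^ k) \<le> 1 + norm x * norm q ^ k"
      using norm_triangle_ineq4[of 1 "x * q ^ k"] by (simp add: norm_mult norm_power)
    also have "\<dots> \<le> exp (norm x * norm q ^ k)" by (rule exp_ge_add_one_self)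
    finally show "norm (1 - x * q ^ k) \<le> exp (norm x * norm q ^ k)" .
  qed
  also have "\<dots> = exp (norm x * (\<Sum>k<n. norm q ^ k))"
    by (simp add: exp_sum sum_distrib_left)
  also have "norm x * (\<Sum>k<n. norm q ^ k) \<le> R * (1 / (1 - norm q))"
  proof (rule mult_mono)
    show "(\<Sum>k<n. norm q ^ k) \<le> 1 / (1 - norm q)"
      using sum_le_suminf[of "\<lambda>k. norm q ^ k" "{..<n}"] q suminf_geometric[of "norm q"] by simp
  qed (use assms order_trans[OF norm_ge_zero assms] in \<open>auto intro!: sum_nonneg\<close>)
  finally show ?thesis by (simp add: qpoch_bound_def)
qed

lemma norm_qpoch_inf_le:
  assumes "norm x \<le> R"
  shows "norm (P x) \<le> qpoch_bound R"
  using norm_qpoch_le[OF assms] tendsto_norm[OF qpoch_LIMSEQ[of x]]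
  by (intro LIMSEQ_le_const2) auto

text \<open>
  The partial products are polynomials that converge uniformly on every disc around \<open>0\<close>.
\<close>

lemma continuous_on_qpoch_inf [continuous_intros]:
  fixes f :: "'a :: topological_space \<Rightarrow> complex"
  assumes "continuous_on S f"
  shows "continuous_on S (\<lambda>x. P (f x))"
proof -
  have "continuous_on (ball 0 R) P" for R :: real
  proof -
    have "uniformly_convergent_on (cball 0 R) (\<lambda>N x. \<Prod>n<N. 1 - x * q ^ n)"
    proof (rule uniformly_convergent_on_prod')
      show "uniformly_convergent_on (cball 0 R) (\<lambda>N x. \<Sum>n<N. norm (1 - x * q ^ n - 1))"
        by (rule Weierstrass_m_test'[where M = "\<lambda>n. R * norm q ^ n"])
           (use q in \<open>auto simp: norm_mult norm_power intro!: mult_right_mono summable_mult summable_geometric\<close>)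
    qed (auto intro!: continuous_intros)
    then obtain L where L: "uniform_limit (cball 0 R) (\<lambda>N x. qpoch x q N) L sequentially"
      by (auto simp: uniformly_convergent_on_def qpoch_def)
    have "continuous_on (cball 0 R) L"
      by (rule uniform_limit_theorem[OF _ L]) (auto simp: qpoch_def intro!: always_eventually continuous_intros)
    moreover have "L x = P x" if "x \<in> cball 0 R" for x
      using tendsto_uniform_limitI[OF L that] qpoch_LIMSEQ LIMSEQ_unique by blast
    ultimately have "continuous_on (cball 0 R) P"
      using continuous_on_cong[of "cball 0 R" "cball 0 R" L P] by blast
    then show ?thesis by (rule continuous_on_subset) auto
  qed
  then have "continuous_on (\<Union>R. ball 0 R) P"
    by (intro continuous_on_open_UN) auto
  moreover have "(\<Union>R. ball 0 R) = (UNIV :: complex set)"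
    by (auto intro: gt_ex)
  ultimately have "continuous_on UNIV P" by simp
  from continuous_on_compose2[OF this assms] show ?thesis by auto
qed

text \<open>
  A closed disc of radius below \<open>1\<close> is compact and contains no zero of the infinite product.  The
  bound is uniform in the base point, so it serves for all shifts \<open>x s q\<^sup>k\<close> and all \<open>s\<close> on the circle at once.
\<close>

lemma inverse_qpoch_inf_bounded:
  assumes "r < 1"
  obtains C where "C > 0" "\<And>x. norm x \<le> r \<Longrightarrow> norm (1 / P x) \<le> C"
proof -
  have "compact ((\<lambda>x. 1 / P x) ` cball 0 r)"
    by (intro compact_continuous_image continuous_intros)
       (use assms in \<open>auto intro!: qpoch_inf_nonzero_disc\<close>)
  from compact_imp_bounded[OF this] obtain C where "C > 0" "\<forall>y\<in>(\<lambda>x. 1 / P x) ` cball 0 r. norm y \<le> C"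
    by (auto simp: bounded_pos)
  then show ?thesis by (intro that[of C]) auto
qed

lemma inverse_qpoch:
  assumes "norm x < 1"
  shows "1 / qpoch x q n = P (x * q ^ n) / P x"
  using qpoch_inf_eq_qpoch_mult[OF q, of x n] qpoch_inf_nonzero_disc[OF assms]
  by (simp add: field_simps)

lemma inverse_qpoch_inf_shift:
  assumes "norm x < 1"
  shows "1 / P (x * q ^ n) = qpoch x q n / P x"
  using qpoch_inf_eq_qpoch_mult[OF q, of x n] qpoch_nonzero[OF assms, of n]
    qpoch_inf_nonzero_disc[OF assms]
  by (simp add: field_simps)

lemma inverse_qpoch_bounded:
  assumes "norm x < 1"
  obtains C where "C > 0" "\<And>n. norm (1 / qpoch x q n) \<le> C"
proof -
  obtain C where C: "C > 0" "\<And>y. norm y \<le> norm x \<Longrightarrow> norm (1 / P y) \<le> C"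
    using inverse_qpoch_inf_bounded[OF assms] by blast
  show ?thesis
  proof (rule that[of "C * qpoch_bound 1"])
    show "C * qpoch_bound 1 > 0" using C by (simp add: qpoch_bound_def)
    fix n
    have "norm (1 / qpoch x q n) = norm (1 / P x) * norm (P (x * q ^ n))"
      by (simp add: inverse_qpoch[OF assms] norm_divide)
    also have "\<dots> \<le> C * qpoch_bound 1"
      by (intro mult_mono C(2) norm_qpoch_inf_le norm_mult_power_less_one[THEN less_imp_le] assms norm_ge_zero order_refl)
         (use C in \<open>auto intro: less_imp_le\<close>)
    finally show "norm (1 / qpoch x q n) \<le> C * qpoch_bound 1" .
  qed
qed

section \<open>The nonterminating q-Gauss sum\<close>

lemma qpoch_q_nonzero [simp]: "qpoch q q n \<noteq> 0"
  by (rule qpoch_nonzero[OF q])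

lemma qpoch_quotient_bounded:
  obtains C where "C > 0" "\<And>n. norm (qpoch A q n * qpoch B q n / qpoch q q n) \<le> C"
proof -
  obtain C where C: "C > 0" "\<And>n. norm (1 / qpoch q q n) \<le> C"
    using inverse_qpoch_bounded[OF q] by blast
  show ?thesis
  proof (rule that[of "qpoch_bound (norm A) * qpoch_bound (norm B) * C"])
    show "qpoch_bound (norm A) * qpoch_bound (norm B) * C > 0" using C by (simp add: qpoch_bound_def)
    fix n
    have "norm (qpoch A q n * qpoch B q n * (1 / qpoch q q n)) \<le> qpoch_bound (norm A) * qpoch_bound (norm B) * C"
      unfolding norm_mult by (intro mult_mono norm_qpoch_le C) auto
    then show "norm (qpoch A q n * qpoch B q n / qpoch q q n) \<le> qpoch_bound (norm A) * qpoch_bound (norm B) * C"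
      by simp
  qed
qed

text \<open>
  The usual form is \<open>\<^sub>2\<phi>\<^sub>1(A,B;C;q,z)\<close> with \<open>C = A B z\<close>.  Here both sides are multiplied by
  \<open>(C;q)\<^sub>\<infinity>\<close>, which clears the denominators \<open>(C;q)\<^sub>k\<close> and admits every \<open>A\<close> and \<open>B\<close>.  The sum \<open>U(z)\<close>
  satisfies \<open>(1 - z) U(z) = (1 - A z) (1 - B z) U(q z)\<close>, because the difference of the two sides
  telescopes; iterating this relation drives the argument to \<open>0\<close>, where \<open>U\<close> is continuous with value \<open>1\<close>.
\<close>

theorem q_gauss:
  assumes z: "norm z < 1"
  shows "(\<lambda>k. qpoch A q k * qpoch B q k / qpoch q q k * z ^ k * P (A * B * z * q ^ k)) sums
           (P (A * z) * P (B * z) / P z)"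
proof -
  define c where "c k = qpoch A q k * qpoch B q k / qpoch q q k" for k
  define u where "u k y = c k * y ^ k * P (A * B * y * q ^ k)" for k y
  define U where "U y = (\<Sum>k. u k y)" for y
  obtain C where C: "C > 0" "\<And>n. norm (c n) \<le> C"
    using qpoch_quotient_bounded unfolding c_def by blast
  define R where "R = norm (A * B)"
  have bound: "norm (u k y) \<le> C * norm z ^ k * qpoch_bound R" if "norm y \<le> norm z" for k y
  proof -
    have "norm y * norm q ^ k \<le> 1 * 1"
      using that z q by (intro mult_mono power_le_one) auto
    then have "norm (A * B) * (norm y * norm q ^ k) \<le> norm (A * B) * 1"
      by (intro mult_left_mono) auto
    then have "norm (A * B * y * q ^ k) \<le> R"
      by (simp add: R_def norm_mult norm_power mult.assoc)
    then show ?thesis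
      unfolding u_def norm_mult norm_power
      using C(1) \<open>norm (A * B * y * q ^ k) \<le> R\<close>
      by (intro mult_mono power_mono C norm_qpoch_inf_le that)
         (auto simp: mult.assoc norm_mult norm_power)
  qed
  have smb: "summable (\<lambda>k. C * norm z ^ k * qpoch_bound R)"
    using z by (intro summable_mult summable_mult2 summable_geometric) auto
  have sums: "(\<lambda>k. u k y) sums U y" if "norm y \<le> norm z" for y
    unfolding U_def
    by (rule summable_sums, rule summable_comparison_test'[OF smb, of 0]) (use bound[OF that] in auto)
  have cont: "continuous_on (cball 0 (norm z)) U"
  proof (rule uniform_limit_theorem)
    show "uniform_limit (cball 0 (norm z)) (\<lambda>n y. \<Sum>k<n. u k y) U sequentially"
      unfolding U_def by (rule Weierstrass_m_test[OF _ smb]) (use bound in auto)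
    show "\<forall>\<^sub>F n in sequentially. continuous_on (cball 0 (norm z)) (\<lambda>y. \<Sum>k<n. u k y)"
      unfolding u_def by (intro always_eventually allI continuous_intros)
  qed auto
  have step: "(1 - y) * U y = (1 - A * y) * (1 - B * y) * U (y * q)" if y: "norm y \<le> norm z" for y
  proof -
    have yq: "norm (y * q) \<le> norm z"
      using y q mult_left_mono[of "norm q" 1 "norm y"] by (simp add: norm_mult)
    \<comment> \<open>The telescoping certificate for the contiguous relation.\<close>
    define T where "T k = - ((1 - q ^ k) * u k y)" for k
    have "(\<lambda>k. u k y) \<longlonglongrightarrow> 0" using sums[OF y] by (intro summable_LIMSEQ_zero) (auto simp: sums_iff)
    moreover have "(\<lambda>k. q ^ k) \<longlonglongrightarrow> 0" by (rule LIMSEQ_power_zero[OF q])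
    ultimately have "T \<longlonglongrightarrow> - ((1 - 0) * 0)" unfolding T_def
      by (intro tendsto_minus tendsto_mult tendsto_diff tendsto_const)
    then have T: "(\<lambda>k. T (Suc k) - T k) sums (0 - T 0)" by (intro telescope_sums) simp
    have "T (Suc k) - T k = (1 - y) * u k y - (1 - A * y) * (1 - B * y) * u k (y * q)" for k
    proof -
      define X where "X = P (A * B * y * q ^ Suc k)"
      have 1: "P (A * B * y * q ^ k) = (1 - A * B * y * q ^ k) * X"
        unfolding X_def by (rule qpoch_inf_shift)
      have 2: "P (A * B * (y * q) * q ^ k) = X" by (simp add: X_def mult_ac)
      have nz: "1 - q ^ Suc k \<noteq> 0"
        using qpoch_q_nonzero[of "Suc k"] by (simp add: qpoch_Suc)
      have 3: "(1 - q ^ Suc k) * c (Suc k) = c k * (1 - A * q ^ k) * (1 - B * q ^ k)"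
        using nz by (simp add: c_def qpoch_Suc field_simps)
      have 4: "(1 - q ^ Suc k) * u (Suc k) y = c k * (1 - A * q ^ k) * (1 - B * q ^ k) * y ^ Suc k * X"
        unfolding u_def 3[symmetric] X_def by (simp only: mult_ac)
      show ?thesis
        unfolding T_def 4 unfolding u_def 1 2 power_mult_distrib by (simp add: algebra_simps)
    qed
    with T have "(\<lambda>k. (1 - y) * u k y - (1 - A * y) * (1 - B * y) * u k (y * q)) sums 0"
      by (simp add: T_def)
    moreover have "(\<lambda>k. (1 - y) * u k y - (1 - A * y) * (1 - B * y) * u k (y * q)) sums
        ((1 - y) * U y - (1 - A * y) * (1 - B * y) * U (y * q))"
      by (intro sums_diff sums_mult sums y yq)
    ultimately show ?thesis using sums_unique2 by fastforce
  qed
  have zq: "norm (z * q ^ n) \<le> norm z" for n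
    using q mult_left_mono[of "norm q ^ n" 1 "norm z"] by (simp add: norm_mult norm_power power_le_one)
  have iter: "qpoch z q n * U z = qpoch (A * z) q n * qpoch (B * z) q n * U (z * q ^ n)" for n
  proof (induction n)
    case (Suc n)
    have "qpoch z q (Suc n) * U z = (1 - z * q ^ n) * (qpoch z q n * U z)"
      by (simp add: qpoch_Suc)
    also have "\<dots> = qpoch (A * z) q n * qpoch (B * z) q n * ((1 - z * q ^ n) * U (z * q ^ n))"
      by (simp add: Suc)
    also have "\<dots> = qpoch (A * z) q (Suc n) * qpoch (B * z) q (Suc n) * U (z * q ^ Suc n)"
      unfolding step[OF zq] by (simp add: qpoch_Suc mult_ac)
    finally show ?case .
  qed simp
  have U0: "U 0 = 1"
  proof -
    have "(\<lambda>k. u k 0) = (\<lambda>k. if k = 0 then 1 else 0)"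
      by (auto simp: u_def c_def)
    then show ?thesis using sums_single[of 0 "\<lambda>_. 1 :: complex"] by (simp add: U_def sums_iff)
  qed
  have "(\<lambda>n. U (z * q ^ n)) \<longlonglongrightarrow> U 0"
  proof (rule continuous_on_tendsto_compose[OF cont])
    show "(\<lambda>n. z * q ^ n) \<longlonglongrightarrow> 0"
      using tendsto_mult_right_zero[OF LIMSEQ_power_zero[OF q]] by simp
  qed (use zq in auto)
  then have "(\<lambda>n. qpoch (A * z) q n * qpoch (B * z) q n * U (z * q ^ n)) \<longlonglongrightarrow> P (A * z) * P (B * z) * 1"
    unfolding U0 by (intro tendsto_intros qpoch_LIMSEQ)
  moreover have "(\<lambda>n. qpoch z q n * U z) \<longlonglongrightarrow> P z * U z"
    by (intro tendsto_intros qpoch_LIMSEQ)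
  ultimately have "P z * U z = P (A * z) * P (B * z)"
    unfolding iter using LIMSEQ_unique by fastforce
  then have "U z = P (A * z) * P (B * z) / P z"
    using qpoch_inf_nonzero_disc[OF z] by (simp add: field_simps)
  with sums[of z] show ?thesis by (simp add: u_def c_def)
qed

corollary q_binomial:
  assumes "norm z < 1"
  shows "(\<lambda>k. qpoch A q k / qpoch q q k * z ^ k) sums (P (A * z) / P z)"
  using q_gauss[OF assms, of A 0] by simp

lemma q_binomial_abs_summable:
  assumes "norm x < 1"
  shows "summable (\<lambda>k. norm (qpoch A q k / qpoch q q k * x ^ k))"
proof -
  obtain C where C: "C > 0" "\<And>n. norm (qpoch A q n * qpoch 0 q n / qpoch q q n) \<le> C"
    using qpoch_quotient_bounded by blast
  have "norm (norm (qpoch A q k / qpoch q q k * x ^ k)) \<le> C * norm x ^ k" for k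
    using mult_right_mono[OF C(2)[of k], of "norm x ^ k"] by (simp add: norm_mult norm_power norm_divide)
  then show ?thesis
    by (intro summable_comparison_test'[OF summable_mult[OF summable_geometric[of "norm x"]]])
       (use assms in auto)
qed

lemma q_binomial_on_circle:
  assumes "norm x < 1" "norm z = 1"
  shows "(\<lambda>k. qpoch A q k / qpoch q q k * x ^ k * z ^ k) sums (P (A * x * z) / P (x * z))"
  using q_binomial[of "x * z" A] assms by (simp add: norm_mult power_mult_distrib mult.assoc)

section \<open>The Cauchy operator on products of shifted factorials\<close>

text \<open>
  The functions \<open>\<phi>(s,t,w;x)\<close> on which the Cauchy operator in \<open>x\<close> acts explicitly.
\<close>

definition kernel :: "complex \<Rightarrow> complex \<Rightarrow> complex \<Rightarrow> complex \<Rightarrow> complex" where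
  "kernel s t w x = P (x * t * w) / (P (x * s) * P (x * t))"

text \<open>
  This is \<open>D\<^sup>n \<phi>(s,t,w;x) / (q;q)\<^sub>n\<close> as given by the \<open>q\<close>-Leibniz rule for the factors
  \<open>P(x t w) / P(x t)\<close> and \<open>1 / P(x s)\<close>.  The quotient \<open>(x s;q)\<^sub>k P(x t w) / ((x t w;q)\<^sub>k P(x s))\<close> is written as
  \<open>P(x t w q\<^sup>k) / P(x s q\<^sup>k)\<close>, which stays meaningful when \<open>(x t w;q)\<^sub>k\<close> vanishes.
\<close>

definition kernel_deriv :: "nat \<Rightarrow> complex \<Rightarrow> complex \<Rightarrow> complex \<Rightarrow> complex \<Rightarrow> complex" where
  "kernel_deriv n s t w x =
     (\<Sum>k\<le>n. qpoch w q k * t ^ k / qpoch q q k * (P (x * t * w * q ^ k) / P (x * s * q ^ k)) *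
            (s ^ (n - k) / qpoch q q (n - k))) / P (x * t)"

text \<open>
  This is \<open>T(g,h) \<phi>(s,t,w;x)\<close>, again with the shifted factorials in the denominators
  absorbed into infinite products; \<open>cauchy_kernel_eq_phi32\<close> gives the hypergeometric form.
\<close>

definition cauchy_kernel ::
    "complex \<Rightarrow> complex \<Rightarrow> complex \<Rightarrow> complex \<Rightarrow> complex \<Rightarrow> complex \<Rightarrow> complex" where
  "cauchy_kernel g h s t w x =
     (\<Sum>k. qpoch g q k * qpoch w q k / qpoch q q k * (h * t) ^ k *
          P (x * t * w * q ^ k) * P (g * h * s * q ^ k) / P (x * s * q ^ k)) / (P (x * t) * P (h * s))"

lemma kernel_deriv_0: "kernel_deriv 0 s t w x = kernel s t w x"
  by (simp add: kernel_deriv_def kernel_def)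

lemma one_minus_q_power_nonzero: "1 - q ^ Suc n \<noteq> 0"
  using qpoch_q_nonzero[of "Suc n"] by (simp add: qpoch_Suc)

text \<open>
  The relation between consecutive \<open>q\<close>-derivatives, \<open>x D\<^sup>n\<^sup>+\<^sup>1 \<phi>(x) = D\<^sup>n \<phi>(x) - D\<^sup>n \<phi>(q x)\<close>, after division by
  \<open>(q;q)\<^sub>n\<close>.  Splitting \<open>1 - q\<^sup>n\<^sup>+\<^sup>1\<close> as \<open>q\<^sup>k (1 - q\<^sup>n\<^sup>+\<^sup>1\<^sup>-\<^sup>k) + (1 - q\<^sup>k)\<close> in the \<open>k\<close>-th term lowers the index of one of
  its two factors, and the two sides then agree summand by summand.
\<close>

lemma kernel_deriv_Suc:
  assumes xs: "norm (x * s) < 1" and xt: "norm (x * t) < 1"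
  shows "x * (1 - q ^ Suc n) * kernel_deriv (Suc n) s t w x =
           kernel_deriv n s t w x - kernel_deriv n s t w (x * q)"
proof -
  define A where "A k = P (x * t * w * q ^ k) / P (x * s * q ^ k)" for k
  define \<alpha> where "\<alpha> k = qpoch w q k * t ^ k / qpoch q q k" for k
  define \<beta> where "\<beta> l = s ^ l / qpoch q q l" for l
  have \<alpha>: "(1 - q ^ Suc k) * \<alpha> (Suc k) = \<alpha> k * (1 - w * q ^ k) * t" for k
    using one_minus_q_power_nonzero[of k] by (simp add: \<alpha>_def qpoch_Suc field_simps)
  have \<beta>: "(1 - q ^ Suc l) * \<beta> (Suc l) = s * \<beta> l" for l
    using one_minus_q_power_nonzero[of l] by (simp add: \<beta>_def qpoch_Suc field_simps)
  have A: "(1 - x * s * q ^ k) * A k = (1 - x * t * w * q ^ k) * A (Suc k)" for k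
  proof -
    have "P (x * s * q ^ k) \<noteq> 0"
      by (rule qpoch_inf_nonzero_disc[OF norm_mult_power_less_one[OF xs]])
    then have "1 - x * s * q ^ k \<noteq> 0"
      using qpoch_inf_shift[of "x * s" k] by (auto simp del: power_Suc)
    then show ?thesis
      unfolding A_def qpoch_inf_shift[of "x * s" k] qpoch_inf_shift[of "x * t * w" k]
      by (simp del: power_Suc)
  qed
  have Aq: "P (x * q * t * w * q ^ k) / P (x * q * s * q ^ k) = A (Suc k)" for k
    by (simp add: A_def mult_ac)
  have Pt: "P (x * t) \<noteq> 0" "P (x * q * t) \<noteq> 0"
    using qpoch_inf_nonzero_disc[OF xt] qpoch_inf_nonzero_disc[OF norm_mult_power_less_one[OF xt, of 1]]
    by (simp_all add: mult_ac)
  have Ptq: "1 / P (x * q * t) = (1 - x * t) / P (x * t)"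
    using Pt qpoch_inf_step[of "x * t"] by (simp add: field_simps)
  have D: "kernel_deriv m s t w x = (\<Sum>k\<le>m. \<alpha> k * A k * \<beta> (m - k)) / P (x * t)" for m
    by (simp add: kernel_deriv_def \<alpha>_def \<beta>_def A_def)
  have "kernel_deriv n s t w (x * q) = (\<Sum>k\<le>n. \<alpha> k * A (Suc k) * \<beta> (n - k)) * (1 / P (x * q * t))"
    unfolding kernel_deriv_def Aq by (simp add: \<alpha>_def \<beta>_def)
  then have Dq: "kernel_deriv n s t w (x * q) =
      (\<Sum>k\<le>n. (1 - x * t) * (\<alpha> k * A (Suc k) * \<beta> (n - k))) / P (x * t)"
    unfolding Ptq by (simp add: sum_distrib_left sum_divide_distrib mult_ac)
  have "x * (1 - q ^ Suc n) * (\<Sum>k\<le>Suc n. \<alpha> k * A k * \<beta> (Suc n - k)) =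
      (\<Sum>k\<le>Suc n. x * q ^ k * \<alpha> k * A k * ((1 - q ^ (Suc n - k)) * \<beta> (Suc n - k)) +
              x * ((1 - q ^ k) * \<alpha> k) * A k * \<beta> (Suc n - k))"
    unfolding sum_distrib_left
  proof (rule sum.cong)
    fix k assume "k \<in> {..Suc n}"
    then have split: "q ^ Suc n = q ^ k * q ^ (Suc n - k)" by (simp flip: power_add)
    have "x * (1 - Q * R) * (y * B * z) = x * Q * y * B * ((1 - R) * z) + x * ((1 - Q) * y) * B * z"
      for Q R y B z :: complex by algebra
    then show "x * (1 - q ^ Suc n) * (\<alpha> k * A k * \<beta> (Suc n - k)) =
        x * q ^ k * \<alpha> k * A k * ((1 - q ^ (Suc n - k)) * \<beta> (Suc n - k)) +
              x * ((1 - q ^ k) * \<alpha> k) * A k * \<beta> (Suc n - k)"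
      unfolding split .
  qed simp
  also have "\<dots> = (\<Sum>k\<le>n. x * q ^ k * \<alpha> k * A k * ((1 - q ^ (Suc n - k)) * \<beta> (Suc n - k))) +
        (\<Sum>k\<le>n. x * ((1 - q ^ Suc k) * \<alpha> (Suc k)) * A (Suc k) * \<beta> (n - k))"
    unfolding sum.distrib
  proof (rule arg_cong2[where f = "(+)"])
    show "(\<Sum>k\<le>Suc n. x * q ^ k * \<alpha> k * A k * ((1 - q ^ (Suc n - k)) * \<beta> (Suc n - k))) =
        (\<Sum>k\<le>n. x * q ^ k * \<alpha> k * A k * ((1 - q ^ (Suc n - k)) * \<beta> (Suc n - k)))"
      by simp
    show "(\<Sum>k\<le>Suc n. x * ((1 - q ^ k) * \<alpha> k) * A k * \<beta> (Suc n - k)) =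
        (\<Sum>k\<le>n. x * ((1 - q ^ Suc k) * \<alpha> (Suc k)) * A (Suc k) * \<beta> (n - k))"
      by (subst sum.atMost_Suc_shift) simp
  qed
  also have "\<dots> = (\<Sum>k\<le>n. \<alpha> k * A k * \<beta> (n - k) - (1 - x * t) * (\<alpha> k * A (Suc k) * \<beta> (n - k)))"
    unfolding sum.distrib [symmetric]
  proof (rule sum.cong)
    fix k assume "k \<in> {..n}"
    then have k: "Suc n - k = Suc (n - k)" by simp
    have "x * s * q ^ k * A k + x * t * (1 - w * q ^ k) * A (Suc k) = A k - (1 - x * t) * A (Suc k)"
    proof -
      have "x * s * q ^ k * A k = A k - (1 - x * s * q ^ k) * A k" by (simp add: left_diff_distrib)
      then show ?thesis unfolding A by (simp add: algebra_simps)
    qed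
    then have expand: "\<alpha> k * \<beta> (n - k) * (x * s * q ^ k * A k + x * t * (1 - w * q ^ k) * A (Suc k)) =
        \<alpha> k * \<beta> (n - k) * (A k - (1 - x * t) * A (Suc k))" by (rule arg_cong)
    have "x * q ^ k * \<alpha> k * A k * ((1 - q ^ (Suc n - k)) * \<beta> (Suc n - k)) +
        x * ((1 - q ^ Suc k) * \<alpha> (Suc k)) * A (Suc k) * \<beta> (n - k) =
        \<alpha> k * \<beta> (n - k) * (x * s * q ^ k * A k + x * t * (1 - w * q ^ k) * A (Suc k))"
      unfolding k \<alpha> \<beta> by (simp add: ring_distribs mult_ac)
    also note expand
    also have "\<alpha> k * \<beta> (n - k) * (A k - (1 - x * t) * A (Suc k)) =
        \<alpha> k * A k * \<beta> (n - k) - (1 - x * t) * (\<alpha> k * A (Suc k) * \<beta> (n - k))"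
      by (simp add: ring_distribs mult_ac)
    finally show "x * q ^ k * \<alpha> k * A k * ((1 - q ^ (Suc n - k)) * \<beta> (Suc n - k)) +
        x * ((1 - q ^ Suc k) * \<alpha> (Suc k)) * A (Suc k) * \<beta> (n - k) =
        \<alpha> k * A k * \<beta> (n - k) - (1 - x * t) * (\<alpha> k * A (Suc k) * \<beta> (n - k))" .
  qed simp
  finally show ?thesis
    unfolding D Dq by (simp add: sum_subtractf diff_divide_distrib)
qed

text \<open>
  One constant serves for all \<open>s\<close> and \<open>t\<close> in the closed unit disc and all bounded \<open>w\<close>, hence for all points of
  the circle at once.  The \<open>n\<close>-th derivative is therefore at most \<open>C (n + 1)\<close>, and the factor \<open>h\<^sup>n\<close>
  makes the operator converge uniformly.
\<close>

lemma kernel_deriv_terms_bounded: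
  assumes "norm x < 1"
  obtains C where "C > 0"
    "\<And>(s :: complex) (t :: complex) (w :: complex) k l. \<lbrakk>norm s \<le> 1; norm t \<le> 1; norm w \<le> W\<rbrakk> \<Longrightarrow>
       norm (qpoch w q k * t ^ k / qpoch q q k * (P (x * t * w * q ^ k) / P (x * s * q ^ k)) *
            (s ^ l / qpoch q q l) / P (x * t)) \<le> C"
proof -
  obtain C where C: "C > 0" "\<And>y. norm y \<le> norm x \<Longrightarrow> norm (1 / P y) \<le> C"
    using inverse_qpoch_inf_bounded[OF assms] by blast
  obtain D where D: "D > 0" "\<And>n. norm (1 / qpoch q q n) \<le> D"
    using inverse_qpoch_bounded[OF q] by blast
  show ?thesis
  proof (rule that[of "qpoch_bound W * 1 * D * (qpoch_bound W * C) * (1 * D) * C"])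
    show "qpoch_bound W * 1 * D * (qpoch_bound W * C) * (1 * D) * C > 0" using C D by (simp add: qpoch_bound_def)
    fix s t w :: complex and k l :: nat
    assume s: "norm s \<le> 1" and t: "norm t \<le> 1" and w: "norm w \<le> W"
    have small: "norm (x * y * q ^ k) \<le> norm x" if "norm y \<le> 1" for y k
    proof -
      have "norm (x * y * q ^ k) \<le> norm x * 1 * 1"
        unfolding norm_mult norm_power using that q by (intro mult_mono power_le_one) auto
      then show ?thesis by simp
    qed
    have "norm (x * t * w * q ^ k) \<le> 1 * 1 * W * 1"
      unfolding norm_mult norm_power using t w q assms order_trans[OF norm_ge_zero w]
      by (intro mult_mono power_le_one) auto
    then have xtw: "norm (x * t * w * q ^ k) \<le> W" by simp
    have "norm (qpoch w q k * t ^ k * (1 / qpoch q q k) * (P (x * t * w * q ^ k) * (1 / P (x * s * q ^ k))) *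
            (s ^ l * (1 / qpoch q q l)) * (1 / P (x * t))) \<le> qpoch_bound W * 1 * D * (qpoch_bound W * C) * (1 * D) * C"
      unfolding norm_mult
    proof (intro mult_mono)
      show "norm (qpoch w q k) \<le> qpoch_bound W" by (rule norm_qpoch_le[OF w])
      show "norm (t ^ k) \<le> 1" "norm (s ^ l) \<le> 1" using s t by (simp_all add: norm_power power_le_one)
      show "norm (1 / P (x * s * q ^ k)) \<le> C" by (rule C(2)[OF small[OF s]])
      show "norm (1 / P (x * t)) \<le> C" using C(2)[OF small[OF t, of 0]] by simp
      show "norm (P (x * t * w * q ^ k)) \<le> qpoch_bound W" by (rule norm_qpoch_inf_le[OF xtw])
    qed (use C(1) D in \<open>auto intro: less_imp_le\<close>)
    then show "norm (qpoch w q k * t ^ k / qpoch q q k * (P (x * t * w * q ^ k) / P (x * s * q ^ k)) *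
            (s ^ l / qpoch q q l) / P (x * t)) \<le> qpoch_bound W * 1 * D * (qpoch_bound W * C) * (1 * D) * C"
      by simp
  qed
qed

lemma cauchy_kernel_summable:
  assumes x: "norm x < 1" and h: "norm h < 1" and s: "norm s \<le> 1" and t: "norm t \<le> 1"
  shows "summable (\<lambda>k. qpoch g q k * qpoch w q k / qpoch q q k * (h * t) ^ k *
          P (x * t * w * q ^ k) * P (g * h * s * q ^ k) / P (x * s * q ^ k))"
proof -
  define \<alpha> where "\<alpha> k = qpoch w q k * t ^ k / qpoch q q k * (P (x * t * w * q ^ k) / P (x * s * q ^ k)) *
      (s ^ 0 / qpoch q q 0) / P (x * t)" for k
  obtain C where C: "C > 0" "\<And>k. norm (\<alpha> k) \<le> C"
    unfolding \<alpha>_def using kernel_deriv_terms_bounded[OF x, of "norm w"] s t by (metis order_refl)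
  have "norm (qpoch g q k * h ^ k * \<alpha> k * P (g * h * s * q ^ k)) \<le>
      qpoch_bound (norm g) * norm h ^ k * C * qpoch_bound (norm g)" for k
  proof -
    have "norm (g * h * s * q ^ k) \<le> norm g * 1 * 1 * 1"
      unfolding norm_mult norm_power using h s q by (intro mult_mono power_le_one) auto
    then show ?thesis
      unfolding norm_mult norm_power[of h]
      using C(1) by (intro mult_mono norm_qpoch_le norm_qpoch_inf_le C(2)) (auto simp: norm_mult norm_power)
  qed
  then have "summable (\<lambda>k. qpoch g q k * h ^ k * \<alpha> k * P (g * h * s * q ^ k))"
    using h by (intro summable_comparison_test'[OF summable_mult2[OF summable_mult2[OF
                  summable_mult[OF summable_geometric[of "norm h"]]]]]) auto
  from summable_mult2[OF this, of "P (x * t)"]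
  show ?thesis
  proof (rule back_subst[of summable], intro ext)
    fix k
    have "norm (x * t) < 1" using mult_left_mono[OF t, of "norm x"] x by (simp add: norm_mult)
    then have "P (x * t) \<noteq> 0" by (rule qpoch_inf_nonzero_disc)
    then show "qpoch g q k * h ^ k * \<alpha> k * P (g * h * s * q ^ k) * P (x * t) =
      qpoch g q k * qpoch w q k / qpoch q q k * (h * t) ^ k *
      P (x * t * w * q ^ k) * P (g * h * s * q ^ k) / P (x * s * q ^ k)"
      by (simp add: \<alpha>_def power_mult_distrib)
  qed
qed

text \<open>
  The operator acting on \<open>\<phi>\<close>.  Writing \<open>n = k + l\<close> and \<open>(g;q)\<^sub>k\<^sub>+\<^sub>l = (g;q)\<^sub>k (g q\<^sup>k;q)\<^sub>l\<close>, the sum over \<open>l\<close> is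
  \<open>P(g h s q\<^sup>k) / P(h s)\<close> by the \<open>q\<close>-binomial theorem, and the sum over \<open>k\<close> remains.
\<close>

lemma cauchy_kernel_sums:
  assumes x: "norm x < 1" and h: "norm h < 1" and s: "norm s \<le> 1" and t: "norm t \<le> 1"
  shows "(\<lambda>n. qpoch g q n * h ^ n * kernel_deriv n s t w x) sums cauchy_kernel g h s t w x"
proof -
  define \<alpha> where "\<alpha> k = qpoch w q k * t ^ k / qpoch q q k * (P (x * t * w * q ^ k) / P (x * s * q ^ k))" for k
  define \<beta> where "\<beta> l = s ^ l / qpoch q q l" for l
  define F where "F k l = qpoch g q (k + l) * h ^ (k + l) * (\<alpha> k * \<beta> l / P (x * t))" for k l
  obtain C where C: "C > 0" "\<And>k l. norm (\<alpha> k * \<beta> l / P (x * t)) \<le> C"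
    unfolding \<alpha>_def \<beta>_def using kernel_deriv_terms_bounded[OF x, of "norm w"] s t by (metis order_refl)
  have "(\<lambda>n. \<Sum>k\<le>n. F k (n - k)) sums (\<Sum>k. \<Sum>l. F k l)"
  proof (rule triangular_sums)
    fix k l
    have "norm (F k l) \<le> qpoch_bound (norm g) * (norm h ^ k * norm h ^ l) * C"
      unfolding F_def norm_mult[of _ "_ / _"] norm_mult[of "qpoch _ _ _"] norm_power power_add[symmetric]
      by (intro mult_mono norm_qpoch_le C(2)) auto
    then show "norm (F k l) \<le> (qpoch_bound (norm g) * norm h ^ k * C) * norm h ^ l" by (simp add: mult_ac)
  qed (use h C in \<open>auto intro!: summable_mult summable_mult2 summable_geometric\<close>)
  moreover have "(\<Sum>k\<le>n. F k (n - k)) = qpoch g q n * h ^ n * kernel_deriv n s t w x" for n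
    unfolding kernel_deriv_def sum_divide_distrib sum_distrib_left
    by (rule sum.cong) (simp_all add: F_def \<alpha>_def \<beta>_def)
  moreover have "(\<Sum>k. \<Sum>l. F k l) = cauchy_kernel g h s t w x"
  proof -
    have hs: "norm (h * s) < 1"
      using mult_left_mono[OF s, of "norm h"] h by (simp add: norm_mult)
    have row: "(\<Sum>l. F k l) = qpoch g q k * qpoch w q k / qpoch q q k * (h * t) ^ k *
          P (x * t * w * q ^ k) * P (g * h * s * q ^ k) / P (x * s * q ^ k) * (1 / (P (x * t) * P (h * s)))" for k
    proof -
      have "F k l = qpoch g q k * h ^ k * \<alpha> k / P (x * t) * (qpoch (g * q ^ k) q l / qpoch q q l * (h * s) ^ l)" for l
        by (simp add: F_def \<beta>_def qpoch_add power_add power_mult_distrib mult_ac)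
      then have "(\<lambda>l. F k l) sums (qpoch g q k * h ^ k * \<alpha> k / P (x * t) * (P (g * q ^ k * (h * s)) / P (h * s)))"
        using sums_mult[OF q_binomial[OF hs, of "g * q ^ k"]] by presburger
      moreover have "g * q ^ k * (h * s) = g * h * s * q ^ k" by (simp add: mult_ac)
      ultimately show ?thesis
        by (simp add: sums_iff \<alpha>_def power_mult_distrib mult_ac)
    qed
    note summ = cauchy_kernel_summable[OF x h s t, of g w]
    show ?thesis
      unfolding cauchy_kernel_def row suminf_mult2[OF summ, symmetric] by simp
  qed
  ultimately show ?thesis by simp
qed

lemma continuous_on_kernel_deriv:
  fixes y s t w :: "'a :: topological_space \<Rightarrow> complex"
  assumes "continuous_on S y" "continuous_on S s" "continuous_on S t" "continuous_on S w"
    and "\<And>p. p \<in> S \<Longrightarrow> norm (y p) < 1" "\<And>p. p \<in> S \<Longrightarrow> norm (s p) \<le> 1" "\<And>p. p \<in> S \<Longrightarrow> norm (t p) \<le> 1"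
  shows "continuous_on S (\<lambda>p. kernel_deriv n (s p) (t p) (w p) (y p))"
proof -
  have small: "norm (y p * v) < 1" if "p \<in> S" "norm v \<le> 1" for p v
    using assms(5)[OF that(1)] mult_left_mono[OF that(2), of "norm (y p)"] by (simp add: norm_mult)
  show ?thesis
    unfolding kernel_deriv_def qpoch_def
    by (intro continuous_intros assms)
       (auto simp: prod_zero_iff qpoch_def[symmetric] intro!: small assms qpoch_inf_nonzero_disc norm_mult_power_less_one)
qed

text \<open>
  The transfer principle.  The hypothesis at \<open>y\<close> and \<open>q y\<close> gives the statement for one more
  \<open>q\<close>-derivative at \<open>y \<noteq> 0\<close>, by \<open>kernel_deriv_Suc\<close>; the value at \<open>0\<close> follows by continuity, and it is used
  in the next step when \<open>q y = 0\<close>.  The uniform bounds then permit summation over all derivatives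
  under the integral sign.
\<close>

proposition circle_mean_cauchy_kernel:
  assumes V: "continuous_on (sphere 0 1) V" and w: "continuous_on (sphere 0 1) w"
    and t: "norm t \<le> 1" and s': "norm s' \<le> 1" and t': "norm t' \<le> 1"
    and x: "norm x < 1" and h: "norm h < 1"
    and kernel: "\<And>y. y \<noteq> 0 \<Longrightarrow> norm y < 1 \<Longrightarrow>
          circle_mean (\<lambda>z. kernel z t (w z) y * V z) = K * kernel s' t' w' y"
  shows "circle_mean (\<lambda>z. cauchy_kernel g h z t (w z) x * V z) = K * cauchy_kernel g h s' t' w' x"
proof -
  have deriv_cont: "continuous_on (sphere 0 1) (\<lambda>z. kernel_deriv n z t (w z) y)" if "norm y < 1" for n y
    by (rule continuous_on_kernel_deriv) (use that t w in \<open>auto intro!: continuous_intros\<close>)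
  have cont: "continuous_on (ball 0 1) (\<lambda>y. circle_mean (\<lambda>z. kernel_deriv n z t (w z) y * V z))" for n
  proof (rule circle_mean_continuous)
    have w2: "continuous_on (ball 0 1 \<times> sphere 0 1) (\<lambda>p :: complex \<times> complex. w (snd p))"
      by (rule continuous_on_compose2[OF w]) (auto intro!: continuous_intros)
    have V2: "continuous_on (ball 0 1 \<times> sphere 0 1) (\<lambda>p :: complex \<times> complex. V (snd p))"
      by (rule continuous_on_compose2[OF V]) (auto intro!: continuous_intros)
    have "continuous_on (ball 0 1 \<times> sphere 0 1)
        (\<lambda>p. kernel_deriv n (snd p) t (w (snd p)) (fst p) * V (snd p))"
      using t by (intro continuous_on_mult continuous_on_kernel_deriv V2 w2)
                 (auto intro!: continuous_intros)
    then show "continuous_on (ball 0 1 \<times> sphere 0 1) (\<lambda>(y, z). kernel_deriv n z t (w z) y * V z)"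
      by (simp add: case_prod_unfold)
  qed
  have cont': "continuous_on (ball 0 1) (\<lambda>y. K * kernel_deriv n s' t' w' y)" for n
    using s' t' by (intro continuous_on_mult continuous_on_kernel_deriv) (auto intro!: continuous_intros)
  have deriv: "circle_mean (\<lambda>z. kernel_deriv n z t (w z) y * V z) = K * kernel_deriv n s' t' w' y"
    if "norm y < 1" for n y
    using that
  proof (induction n arbitrary: y)
    case 0
    show ?case
    proof (cases "y = 0")
      case True
      then show ?thesis
        using eq_at_0_if_eq_nearby[OF cont[of 0] cont'[of 0]] kernel by (simp add: kernel_deriv_0)
    qed (use kernel 0 in \<open>simp add: kernel_deriv_0\<close>)
  next
    case (Suc n)
    have main: "circle_mean (\<lambda>z. kernel_deriv (Suc n) z t (w z) y * V z) = K * kernel_deriv (Suc n) s' t' w' y"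
      if y: "norm y < 1" and y0: "y \<noteq> 0" for y
    proof -
      have yq: "norm (y * q) < 1" using norm_mult_power_less_one[OF y, of 1] by simp
      define \<kappa> where "\<kappa> = y * (1 - q ^ Suc n)"
      have \<kappa>: "\<kappa> \<noteq> 0" using y0 one_minus_q_power_nonzero[of n] by (simp add: \<kappa>_def)
      have small: "norm (y * v) < 1" if "norm v \<le> 1" for v
        using y mult_left_mono[OF that, of "norm y"] by (simp add: norm_mult)
      have "\<kappa> * circle_mean (\<lambda>z. kernel_deriv (Suc n) z t (w z) y * V z) =
          circle_mean (\<lambda>z. \<kappa> * (kernel_deriv (Suc n) z t (w z) y * V z))"
        by (rule circle_mean_cmult [symmetric])
      also have "\<dots> = circle_mean (\<lambda>z. kernel_deriv n z t (w z) y * V z - kernel_deriv n z t (w z) (y * q) * V z)"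
      proof (rule circle_mean_cong)
        fix z :: complex assume "norm z = 1"
        then have "\<kappa> * kernel_deriv (Suc n) z t (w z) y = kernel_deriv n z t (w z) y - kernel_deriv n z t (w z) (y * q)"
          unfolding \<kappa>_def by (intro kernel_deriv_Suc small t) simp
        then show "\<kappa> * (kernel_deriv (Suc n) z t (w z) y * V z) =
            kernel_deriv n z t (w z) y * V z - kernel_deriv n z t (w z) (y * q) * V z"
          unfolding mult.assoc[symmetric] left_diff_distrib[symmetric] by simp
      qed
      also have "\<dots> = K * kernel_deriv n s' t' w' y - K * kernel_deriv n s' t' w' (y * q)"
        by (subst circle_mean_diff) (auto intro!: continuous_intros deriv_cont V y yq simp: Suc.IH y yq)
      also have "\<dots> = \<kappa> * (K * kernel_deriv (Suc n) s' t' w' y)"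
        using kernel_deriv_Suc[OF small[OF s'] small[OF t'], of n w', folded \<kappa>_def]
        by (simp add: right_diff_distrib [symmetric] mult.left_commute)
      finally show ?thesis using \<kappa> by simp
    qed
    show ?case
      using eq_at_0_if_eq_nearby[OF cont[of "Suc n"] cont'[of "Suc n"]] main Suc.prems by (cases "y = 0") auto
  qed
  obtain W where W: "\<And>z. norm z = 1 \<Longrightarrow> norm (w z) \<le> W"
  proof -
    have "compact (w ` sphere 0 1)" by (intro compact_continuous_image w) auto
    then obtain W where "\<forall>y\<in>w ` sphere 0 1. norm y \<le> W"
      using compact_imp_bounded bounded_iff by blast
    then show ?thesis by (intro that[of W]) auto
  qed
  obtain C where C: "C > 0"
    "\<And>(s :: complex) (t :: complex) (w :: complex) k l. \<lbrakk>norm s \<le> 1; norm t \<le> 1; norm w \<le> W\<rbrakk> \<Longrightarrow>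
       norm (qpoch w q k * t ^ k / qpoch q q k * (P (x * t * w * q ^ k) / P (x * s * q ^ k)) *
            (s ^ l / qpoch q q l) / P (x * t)) \<le> C"
    using kernel_deriv_terms_bounded[OF x, of W] by blast
  define u where "u n z = qpoch g q n * h ^ n * kernel_deriv n z t (w z) x" for n z
  have "(\<lambda>n. circle_mean (\<lambda>z. u n z * V z)) sums circle_mean (\<lambda>z. (\<Sum>n. u n z) * V z)"
  proof (rule circle_mean_sums[OF _ _ _ V])
    show "continuous_on (sphere 0 1) (u n)" for n
      unfolding u_def by (intro continuous_intros deriv_cont x)
    have "summable (\<lambda>n. \<Sum>k\<le>n. norm h ^ k * norm h ^ (n - k))"
      by (rule summable_Cauchy_product) (use h in auto)
    then show "summable (\<lambda>n. qpoch_bound (norm g) * C * (\<Sum>k\<le>n. norm h ^ k * norm h ^ (n - k)))"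
      by (rule summable_mult)
    show "norm (u n z) \<le> qpoch_bound (norm g) * C * (\<Sum>k\<le>n. norm h ^ k * norm h ^ (n - k))" if z: "norm z = 1" for n z
    proof -
      have "norm (kernel_deriv n z t (w z) x) \<le> (\<Sum>k\<le>n. C)"
        unfolding kernel_deriv_def sum_divide_distrib
        by (rule sum_norm_le) (use C(2) z t W in auto)
      then have "norm (u n z) \<le> qpoch_bound (norm g) * norm h ^ n * (\<Sum>k\<le>n. C)"
        unfolding u_def norm_mult norm_power by (intro mult_mono norm_qpoch_le) auto
      also have "\<dots> = qpoch_bound (norm g) * C * (\<Sum>k\<le>n. norm h ^ k * norm h ^ (n - k))"
        by (simp flip: power_add)
      finally show ?thesis .
    qed
  qed
  moreover have "circle_mean (\<lambda>z. (\<Sum>n. u n z) * V z) = circle_mean (\<lambda>z. cauchy_kernel g h z t (w z) x * V z)"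
    unfolding u_def by (intro circle_mean_cong arg_cong2[where f = "(*)"] refl)
      (use cauchy_kernel_sums[OF x h _ t] in \<open>auto simp: sums_iff\<close>)
  moreover have "circle_mean (\<lambda>z. u n z * V z) = K * (qpoch g q n * h ^ n * kernel_deriv n s' t' w' x)" for n
  proof -
    have "circle_mean (\<lambda>z. u n z * V z) =
        circle_mean (\<lambda>z. qpoch g q n * h ^ n * (kernel_deriv n z t (w z) x * V z))"
      by (intro circle_mean_cong) (simp add: u_def)
    then show ?thesis unfolding circle_mean_cmult deriv[OF x] by simp
  qed
  ultimately have "(\<lambda>n. K * (qpoch g q n * h ^ n * kernel_deriv n s' t' w' x)) sums
      circle_mean (\<lambda>z. cauchy_kernel g h z t (w z) x * V z)" by simp
  moreover have "(\<lambda>n. K * (qpoch g q n * h ^ n * kernel_deriv n s' t' w' x)) sums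
      (K * cauchy_kernel g h s' t' w' x)"
    by (intro sums_mult cauchy_kernel_sums x h s' t')
  ultimately show ?thesis by (rule sums_unique2)
qed

section \<open>Closed forms of the transformed kernel\<close>

text \<open>
  For \<open>t = 0\<close> only the first term of the series survives.
\<close>

lemma cauchy_kernel_t_zero: "cauchy_kernel g h s 0 w x = P (g * h * s) / (P (x * s) * P (h * s))"
proof -
  have "(\<lambda>k. qpoch g q k * qpoch w q k / qpoch q q k * (h * 0) ^ k *
          P (x * 0 * w * q ^ k) * P (g * h * s * q ^ k) / P (x * s * q ^ k)) =
        (\<lambda>k. if k = 0 then P (g * h * s) / P (x * s) else 0)"
    by auto
  then show ?thesis
    using sums_single[of 0 "\<lambda>_. P (g * h * s) / P (x * s)"]
    unfolding cauchy_kernel_def by (simp add: sums_iff)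
qed

text \<open>
  If \<open>w = g h s\<close>, one numerator parameter cancels one denominator parameter of the \<open>\<^sub>3\<phi>\<^sub>2\<close> series, and
  what is left is a \<open>q\<close>-Gauss sum with parameters \<open>g\<close>, \<open>x s\<close> and argument \<open>h t\<close>.
\<close>

lemma cauchy_kernel_balanced:
  assumes w: "g * h * s = w" and xs: "norm (x * s) < 1" and ht: "norm (h * t) < 1"
  shows "cauchy_kernel g h s t w x =
           P w * P (g * h * t) * P (x * s * h * t) / (P (x * t) * P (h * s) * P (x * s) * P (h * t))"
proof -
  have xtw: "x * t * w = g * (x * s) * (h * t)" by (simp add: w [symmetric])
  have "qpoch g q k * qpoch w q k / qpoch q q k * (h * t) ^ k *
          P (x * t * w * q ^ k) * P (g * h * s * q ^ k) / P (x * s * q ^ k) =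
        P w / P (x * s) * (qpoch g q k * qpoch (x * s) q k / qpoch q q k * (h * t) ^ k *
          P (g * (x * s) * (h * t) * q ^ k))" for k
  proof -
    have "qpoch g q k * qpoch w q k / qpoch q q k * (h * t) ^ k *
          P (x * t * w * q ^ k) * P (g * h * s * q ^ k) / P (x * s * q ^ k) =
        qpoch g q k / qpoch q q k * (h * t) ^ k * P (x * t * w * q ^ k) *
          (qpoch w q k * P (w * q ^ k)) * (1 / P (x * s * q ^ k))"
      by (simp add: w)
    also have "\<dots> = qpoch g q k / qpoch q q k * (h * t) ^ k * P (x * t * w * q ^ k) *
          P w * (qpoch (x * s) q k / P (x * s))"
      unfolding qpoch_inf_eq_qpoch_mult[OF q, of w k, symmetric] inverse_qpoch_inf_shift[OF xs] ..
    also have "\<dots> = P w / P (x * s) * (qpoch g q k * qpoch (x * s) q k / qpoch q q k * (h * t) ^ k *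
          P (x * t * w * q ^ k))" by (simp add: mult_ac)
    finally show ?thesis unfolding xtw .
  qed
  moreover have "(\<lambda>k. P w / P (x * s) * (qpoch g q k * qpoch (x * s) q k / qpoch q q k * (h * t) ^ k *
          P (g * (x * s) * (h * t) * q ^ k))) sums
        (P w / P (x * s) * (P (g * (h * t)) * P (x * s * (h * t)) / P (h * t)))"
    by (intro sums_mult q_gauss ht)
  ultimately show ?thesis
    unfolding cauchy_kernel_def by (simp add: sums_iff mult_ac)
qed

text \<open>
  When no denominator vanishes, the infinite products can be traded back for shifted factorials.
\<close>

lemma cauchy_kernel_eq_phi32:
  assumes x: "norm x < 1" and h: "norm h < 1" and s: "norm s \<le> 1" and t: "norm t \<le> 1"
    and xtw: "norm (x * t * w) < 1" and ghs: "\<And>k. g * h * s * q ^ k \<noteq> 1"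
  shows "cauchy_kernel g h s t w x =
           P (x * t * w) * P (g * h * s) / (P (x * s) * P (x * t) * P (h * s)) *
           phi32 g (x * s) w (g * h * s) (x * t * w) q (h * t)"
proof -
  have xs: "norm (x * s) < 1"
    using mult_left_mono[OF s, of "norm x"] x by (simp add: norm_mult)
  have summand: "qpoch g q k * qpoch w q k / qpoch q q k * (h * t) ^ k *
          P (x * t * w * q ^ k) * P (g * h * s * q ^ k) / P (x * s * q ^ k) =
        P (x * t * w) * P (g * h * s) / P (x * s) *
         (qpochs [g, x * s, w] q k / qpochs [q, g * h * s, x * t * w] q k * (h * t) ^ k)" for k
  proof -
    have "qpoch (g * h * s) q k \<noteq> 0" using ghs by (auto simp: qpoch_def)
    then have 1: "P (g * h * s * q ^ k) = P (g * h * s) / qpoch (g * h * s) q k"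
      using qpoch_inf_eq_qpoch_mult[OF q, of "g * h * s" k] by simp
    have 2: "P (x * t * w * q ^ k) = P (x * t * w) / qpoch (x * t * w) q k"
      using qpoch_inf_eq_qpoch_mult[OF q, of "x * t * w" k] qpoch_nonzero[OF xtw, of k] by simp
    have "qpoch g q k * qpoch w q k / qpoch q q k * (h * t) ^ k *
          P (x * t * w * q ^ k) * P (g * h * s * q ^ k) / P (x * s * q ^ k) =
        qpoch g q k * qpoch w q k / qpoch q q k * (h * t) ^ k *
          P (x * t * w * q ^ k) * P (g * h * s * q ^ k) * (1 / P (x * s * q ^ k))" by simp
    also have "\<dots> = P (x * t * w) * P (g * h * s) / P (x * s) *
         (qpochs [g, x * s, w] q k / qpochs [q, g * h * s, x * t * w] q k * (h * t) ^ k)"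
      unfolding 1 2 inverse_qpoch_inf_shift[OF xs] by (simp add: qpochs_def mult_ac)
    finally show ?thesis .
  qed
  have "P (x * t * w) * P (g * h * s) / P (x * s) \<noteq> 0"
    using qpoch_inf_nonzero[OF ghs] qpoch_inf_nonzero_disc[OF xs] qpoch_inf_nonzero_disc[OF xtw] by simp
  then have "summable (\<lambda>k. qpochs [g, x * s, w] q k / qpochs [q, g * h * s, x * t * w] q k * (h * t) ^ k)"
    using cauchy_kernel_summable[OF x h s t, of g w] unfolding summand summable_cmult_iff by blast
  note pull_out = suminf_mult[OF this]
  show ?thesis
    unfolding cauchy_kernel_def summand pull_out phi32_def by simp
qed

section \<open>The seed integral\<close>

text \<open>
  The constant term of the product of three \<open>q\<close>-binomial series.  With \<open>\<nu> = q / (c \<rho> b)\<close> the factor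
  depending on \<open>b\<close> is \<open>P(\<nu> b z) / P(b z)\<close>.  For a fixed power \<open>d\<^sup>m\<close> the sum over the powers of \<open>c\<close> has
  parameters \<open>\<rho>\<close>, \<open>\<nu> q\<^sup>m\<close> and argument \<open>b c\<close>, whose product is \<open>q\<^sup>m\<^sup>+\<^sup>1\<close>: exactly the \<open>q\<close>-Gauss condition for
  the denominators \<open>(q;q)\<^sub>m\<^sub>+\<^sub>j\<close>.  The sum over \<open>m\<close> that remains is a \<open>q\<close>-binomial series.
\<close>

lemma circle_mean_seed:
  assumes b: "b \<noteq> 0" "norm b < 1" and c: "c \<noteq> 0" "norm c < 1" and d: "norm d < 1" and \<rho>: "\<rho> \<noteq> 0"
  shows "circle_mean (\<lambda>z. P (q / (c * \<rho>) * z) / P (b * z) *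
             (P (q / \<rho> * d * (1 / z)) / P (d * (1 / z)) * (P (\<rho> * c * (1 / z)) / P (c * (1 / z))))) =
         P (q / \<rho>) * P (b * c * \<rho>) * P (d * q / (\<rho> * c)) / (P q * P (b * c) * P (b * d))"
proof -
  define \<nu> where "\<nu> = q / (c * \<rho> * b)"
  define \<sigma> where "\<sigma> = q / \<rho>"
  define f where "f z = P (\<nu> * b * z) / P (b * z)" for z
  define G where "G A x z = P (A * x * (1 / z)) / P (x * (1 / z))" for A x z
  define \<alpha> where "\<alpha> n = qpoch \<nu> q n / qpoch q q n * b ^ n" for n
  define \<beta> where "\<beta> A x n = qpoch A q n / qpoch q q n * x ^ n" for A x n
  have nz: "P (x * v) \<noteq> 0" if "norm x < 1" "norm v = 1" for x v
    using that by (intro qpoch_inf_nonzero_disc) (simp add: norm_mult)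
  have bc: "norm (b * c) < 1" and bd: "norm (b * d) < 1"
    using b(2) c(2) d mult_strict_mono'[of "norm b" 1 "norm c" 1] mult_strict_mono'[of "norm b" 1 "norm d" 1]
    by (auto simp: norm_mult)
  have f_cont: "continuous_on (sphere 0 1) f"
    unfolding f_def by (intro continuous_intros) (use nz b in auto)
  have G_cont: "continuous_on (sphere 0 1) (G A x)" if "norm x < 1" for A x
  proof -
    have "P (x * (1 / z)) \<noteq> 0" if "norm z = 1" for z
      by (rule nz[OF \<open>norm x < 1\<close>]) (use that in \<open>simp add: norm_divide\<close>)
    then show ?thesis
      unfolding G_def by (intro continuous_intros) auto
  qed
  have G_sums: "(\<lambda>j. \<beta> A x j * (1 / z) ^ j) sums G A x z" if "norm x < 1" "norm z = 1" for A x z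
    unfolding \<beta>_def G_def by (rule q_binomial_on_circle) (use that in \<open>auto simp: norm_divide\<close>)
  have \<beta>_summable: "summable (\<lambda>j. norm (\<beta> A x j))" if "norm x < 1" for A x
    unfolding \<beta>_def by (rule q_binomial_abs_summable[OF that])
  have coeff: "circle_mean (\<lambda>z. (1 / z) ^ m * f z) = \<alpha> m" for m
  proof -
    have "circle_mean (\<lambda>z. (1 / z) ^ m * f z) = circle_mean (\<lambda>z. (\<Sum>n. \<alpha> n * z ^ n) * (1 / z ^ m))"
    proof (rule circle_mean_cong)
      fix z :: complex assume "norm z = 1"
      then have "(\<Sum>n. \<alpha> n * z ^ n) = f z"
        using q_binomial_on_circle[OF b(2), of z \<nu>] by (simp add: \<alpha>_def f_def sums_iff)
      then show "(1 / z) ^ m * f z = (\<Sum>n. \<alpha> n * z ^ n) * (1 / z ^ m)"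
        by (simp add: power_divide)
    qed
    also have "\<dots> = \<alpha> m"
      unfolding \<alpha>_def by (rule circle_mean_power_series[OF q_binomial_abs_summable[OF b(2)]])
    finally show ?thesis .
  qed
  have inner: "circle_mean (\<lambda>z. (1 / z) ^ m * (G \<rho> c z * f z)) =
      b ^ m * qpoch \<nu> q m / P q * (P (b * c * \<rho>) * P (\<sigma> * q ^ m) / P (b * c))" for m
  proof -
    have expansion: "(\<lambda>j. \<beta> \<rho> c j * circle_mean (\<lambda>z. (1 / z) ^ j * ((1 / z) ^ m * f z))) sums
        circle_mean (\<lambda>z. G \<rho> c z * ((1 / z) ^ m * f z))"
      by (rule circle_mean_negative_series[OF \<beta>_summable[OF c(2)] G_sums[OF c(2)]])
         (auto intro!: continuous_intros f_cont)
    have summand: "\<beta> \<rho> c j * circle_mean (\<lambda>z. (1 / z) ^ j * ((1 / z) ^ m * f z)) =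
        b ^ m * qpoch \<nu> q m / P q * (qpoch \<rho> q j * qpoch (\<nu> * q ^ m) q j / qpoch q q j * (b * c) ^ j *
          P (\<rho> * (\<nu> * q ^ m) * (b * c) * q ^ j))" for j
    proof -
      have "circle_mean (\<lambda>z. (1 / z) ^ j * ((1 / z) ^ m * f z)) = \<alpha> (m + j)"
        unfolding coeff[symmetric] by (simp add: power_add mult_ac)
      also have "\<alpha> (m + j) = qpoch \<nu> q m * qpoch (\<nu> * q ^ m) q j * (1 / qpoch q q (m + j)) * b ^ (m + j)"
        unfolding \<alpha>_def qpoch_add[of \<nu>] by simp
      also have "1 / qpoch q q (m + j) = P (\<rho> * (\<nu> * q ^ m) * (b * c) * q ^ j) / P q"
        unfolding inverse_qpoch[OF q] using b c \<rho> by (simp add: \<nu>_def power_add mult_ac)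
      finally show ?thesis by (simp add: \<beta>_def power_add power_mult_distrib mult_ac)
    qed
    have gauss: "(\<lambda>j. b ^ m * qpoch \<nu> q m / P q * (qpoch \<rho> q j * qpoch (\<nu> * q ^ m) q j / qpoch q q j *
          (b * c) ^ j * P (\<rho> * (\<nu> * q ^ m) * (b * c) * q ^ j))) sums
        (b ^ m * qpoch \<nu> q m / P q * (P (\<rho> * (b * c)) * P (\<nu> * q ^ m * (b * c)) / P (b * c)))"
      by (intro sums_mult q_gauss bc)
    have args: "\<rho> * (b * c) = b * c * \<rho>" "\<nu> * q ^ m * (b * c) = \<sigma> * q ^ m"
      using b c \<rho> by (simp_all add: \<nu>_def \<sigma>_def)
    have "(\<lambda>z. (1 / z) ^ m * (G \<rho> c z * f z)) = (\<lambda>z. G \<rho> c z * ((1 / z) ^ m * f z))"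
      by (simp add: mult_ac)
    with sums_unique2[OF expansion[unfolded summand] gauss] show ?thesis
      unfolding args by simp
  qed
  have expansion: "(\<lambda>m. \<beta> \<sigma> d m * circle_mean (\<lambda>z. (1 / z) ^ m * (G \<rho> c z * f z))) sums
      circle_mean (\<lambda>z. G \<sigma> d z * (G \<rho> c z * f z))"
    by (rule circle_mean_negative_series[OF \<beta>_summable[OF d] G_sums[OF d]])
       (auto intro!: continuous_intros f_cont G_cont c)
  have summand: "\<beta> \<sigma> d m * circle_mean (\<lambda>z. (1 / z) ^ m * (G \<rho> c z * f z)) =
      P (b * c * \<rho>) * P \<sigma> / (P q * P (b * c)) * (qpoch \<nu> q m / qpoch q q m * (b * d) ^ m)" for m
    unfolding inner \<beta>_def qpoch_inf_eq_qpoch_mult[OF q, of \<sigma> m]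
    by (simp add: power_mult_distrib mult_ac)
  have binomial: "(\<lambda>m. P (b * c * \<rho>) * P \<sigma> / (P q * P (b * c)) * (qpoch \<nu> q m / qpoch q q m * (b * d) ^ m)) sums
      (P (b * c * \<rho>) * P \<sigma> / (P q * P (b * c)) * (P (\<nu> * (b * d)) / P (b * d)))"
    by (intro sums_mult q_binomial bd)
  have args: "\<nu> * (b * d) = d * q / (\<rho> * c)" "\<nu> * b = q / (c * \<rho>)"
    using b by (simp_all add: \<nu>_def mult_ac)
  have "circle_mean (\<lambda>z. f z * (G \<sigma> d z * G \<rho> c z)) = circle_mean (\<lambda>z. G \<sigma> d z * (G \<rho> c z * f z))"
    by (simp add: mult_ac)
  also have "\<dots> = P (b * c * \<rho>) * P \<sigma> / (P q * P (b * c)) * (P (d * q / (\<rho> * c)) / P (b * d))"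
    using sums_unique2[OF expansion[unfolded summand] binomial] unfolding args .
  finally show ?thesis
    unfolding f_def G_def args \<sigma>_def by simp
qed

end

section \<open>The integral with a series in the integrand\<close>

theorem theorem4p1:
  fixes a b c d f g h \<rho> q :: complex
  assumes q: "norm q < 1"
    and bound: "Max {norm a, norm b, norm c, norm d, norm f, norm h} < 1"
    and nonzero: "c * d * \<rho> \<noteq> 0"
    and denom_left: "\<And>\<theta> k. \<theta> \<in> {-pi..pi} \<Longrightarrow> g * h * exp (\<i> * of_real \<theta>) * q ^ k \<noteq> 1"
    and denom_right: "\<And>k. c * g * h * q ^ k \<noteq> 1"
  shows
    "1 / (2 * of_real pi) *
       integral {-pi..pi} (\<lambda>\<theta>.
         (let e = exp (\<i> * of_real \<theta>); e' = exp (- \<i> * of_real \<theta>) in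
            qpochs_inf [\<rho> * e / d, q * d * e' / \<rho>, \<rho> * c * e', q * e / (c * \<rho>),
                        a * b * c * d * f * e, g * h * e] q
            / qpochs_inf [a * e, b * e, f * e, h * e, c * e', d * e'] q
            * phi32 g (a * e) (f * e) (g * h * e) (a * b * c * d * f * e) q (b * c * d * h)))
     = qpochs_inf [a * b * c * d, \<rho> * c / d, d * q / (\<rho> * c), \<rho>, q / \<rho>,
                   b * c * d * f, a * c * d * f, c * g * h] q
       / qpochs_inf [q, a * c, a * d, b * c, b * d, c * f, c * h, d * f] q
       * phi32 g (a * c) (c * f) (c * g * h) (a * c * d * f) q (d * h)"
proof -
  interpret q_disc q by unfold_locales (rule q)
  have norms: "norm a < 1" "norm b < 1" "norm c < 1" "norm d < 1" "norm f < 1" "norm h < 1"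
    using bound by auto
  have nonzeros: "c \<noteq> 0" "d \<noteq> 0" "\<rho> \<noteq> 0" using nonzero by auto
  have less1: "norm (x * y) < 1" if "norm x < 1" "norm y < 1" for x y :: complex
    using mult_strict_mono'[of "norm x" 1 "norm y" 1] that by (simp add: norm_mult)
  have on_circle: "norm (x * z) < 1" "norm (x * (1 / z)) < 1" if "norm x < 1" "norm z = 1" for x z :: complex
    using that by (simp_all add: norm_mult norm_divide)
  have bcd: "norm (b * c * d) < 1" "norm (b * c * d) \<le> 1"
    using norms by (auto intro!: less1 less_imp_le)
  have nz: "P x \<noteq> 0" if "norm x < 1" for x using that by (rule qpoch_inf_nonzero_disc)
  \<comment> \<open>The weights carry the part of the integrand that the operator of the respective step leaves
    alone: \<open>V\<^sub>1\<close> goes with \<open>x = b\<close>, while \<open>V\<^sub>2\<close> and \<open>V\<^sub>3\<close> go with \<open>x = a\<close>.\<close>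
  define V\<^sub>1 where "V\<^sub>1 z = P (q / (c * \<rho>) * z) *
     (P (q / \<rho> * d * (1 / z)) / P (d * (1 / z)) * (P (\<rho> * c * (1 / z)) / P (c * (1 / z))))" for z
  define V\<^sub>2 where "V\<^sub>2 z = P (\<rho> / d * z) / P (b * z) * V\<^sub>1 z" for z
  define V\<^sub>3 where "V\<^sub>3 z = V\<^sub>2 z / P (f * z)" for z
  have nz_circle: "P (x * z) \<noteq> 0" "P (x * (1 / z)) \<noteq> 0" if "norm x < 1" "norm z = 1" for x z
    using on_circle[OF that] by (simp_all only: nz not_False_eq_True)
  have cont\<^sub>1: "continuous_on (sphere 0 1) V\<^sub>1"
    unfolding V\<^sub>1_def using nz_circle(2) norms by (intro continuous_intros) auto
  have cont\<^sub>2: "continuous_on (sphere 0 1) V\<^sub>2"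
    unfolding V\<^sub>2_def using nz_circle(1) norms by (intro continuous_intros cont\<^sub>1) auto
  have cont\<^sub>3: "continuous_on (sphere 0 1) V\<^sub>3"
    unfolding V\<^sub>3_def using nz_circle(1) norms by (intro continuous_intros cont\<^sub>2) auto
  define w where "w = c * \<rho> / d"
  define K\<^sub>1 where "K\<^sub>1 = P (q / \<rho>) * P (d * q / (\<rho> * c)) / P q"
  define K\<^sub>2 where "K\<^sub>2 = K\<^sub>1 * P w * P \<rho> / (P (b * d) * P (b * c))"
  define K\<^sub>3 where "K\<^sub>3 = K\<^sub>2 * P (b * c * d * f) / (P (c * f) * P (d * f))"

  have base\<^sub>1: "circle_mean (\<lambda>z. kernel z 0 0 y * V\<^sub>1 z) = K\<^sub>1 * kernel c d w y"
    if "y \<noteq> 0" "norm y < 1" for y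
  proof -
    have "circle_mean (\<lambda>z. kernel z 0 0 y * V\<^sub>1 z) =
        circle_mean (\<lambda>z. P (q / (c * \<rho>) * z) / P (y * z) *
          (P (q / \<rho> * d * (1 / z)) / P (d * (1 / z)) * (P (\<rho> * c * (1 / z)) / P (c * (1 / z)))))"
      by (simp add: kernel_def V\<^sub>1_def)
    also have "\<dots> = P (q / \<rho>) * P (y * c * \<rho>) * P (d * q / (\<rho> * c)) / (P q * P (y * c) * P (y * d))"
      by (rule circle_mean_seed) (use that norms nonzeros in auto)
    also have "\<dots> = K\<^sub>1 * kernel c d w y"
      using nonzeros by (simp add: K\<^sub>1_def kernel_def w_def mult_ac)
    finally show ?thesis .
  qed

  have base\<^sub>2: "circle_mean (\<lambda>z. kernel z (b * c * d) 0 y * V\<^sub>2 z) = K\<^sub>2 * kernel c d 0 y"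
    if y: "y \<noteq> 0" "norm y < 1" for y
  proof -
    \<comment> \<open>With this \<open>\<gamma>\<close> the operator creates the factor \<open>P(\<rho> z/d)\<close> in the integrand, and
      \<open>\<gamma> y c = w\<close> makes the series on the right balanced.\<close>
    define \<gamma> where "\<gamma> = \<rho> / (y * d)"
    have \<gamma>: "\<gamma> * y = \<rho> / d" "\<gamma> * y * c = w" "\<gamma> * y * d = \<rho>"
      using y nonzeros by (simp_all add: \<gamma>_def w_def)
    have "circle_mean (\<lambda>z. kernel z (b * c * d) 0 y * V\<^sub>2 z) =
        circle_mean (\<lambda>z. 1 / P (y * (b * c * d)) * (cauchy_kernel \<gamma> y z 0 0 b * V\<^sub>1 z))"
      by (simp add: kernel_def cauchy_kernel_t_zero V\<^sub>2_def \<gamma> mult_ac)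
    also have "\<dots> = 1 / P (y * (b * c * d)) * (K\<^sub>1 * cauchy_kernel \<gamma> y c d w b)"
      unfolding circle_mean_cmult
      by (subst circle_mean_cauchy_kernel[OF cont\<^sub>1 _ _ _ _ _ _ base\<^sub>1]) (use norms y in auto)
    also have "cauchy_kernel \<gamma> y c d w b = P w * P \<rho> * P (y * (b * c * d)) /
        (P (b * d) * P (y * c) * P (b * c) * P (y * d))"
      unfolding cauchy_kernel_balanced[OF \<gamma>(2) less1[OF norms(2,3)] less1[OF y(2) norms(4)]] \<gamma>(3)
      by (simp add: mult_ac)
    also have "1 / P (y * (b * c * d)) * (K\<^sub>1 * \<dots>) = K\<^sub>2 * kernel c d 0 y"
      using nz[OF less1[OF y(2) bcd(1)]] by (simp add: K\<^sub>2_def kernel_def mult_ac)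
    finally show ?thesis .
  qed

  \<comment> \<open>Dividing by the \<open>a\<close>-dependent factor \<open>P(a b c d)\<close> has turned \<open>1 / P(a z)\<close> into a kernel
    with \<open>t = b c d\<close>; the operator then supplies the numerator \<open>P(a b c d f z)\<close>.\<close>
  have base\<^sub>3: "circle_mean (\<lambda>z. kernel z (b * c * d) (f * z) y * V\<^sub>3 z) = K\<^sub>3 * kernel c d (c * f) y"
    if y: "norm y < 1" for y
  proof -
    have "circle_mean (\<lambda>z. kernel z (b * c * d) (f * z) y * V\<^sub>3 z) =
        circle_mean (\<lambda>z. P (b * c * d * f) * (cauchy_kernel 0 f z (b * c * d) 0 y * V\<^sub>2 z))"
    proof (rule circle_mean_cong)
      fix z :: complex assume z: "norm z = 1"
      have "cauchy_kernel 0 f z (b * c * d) 0 y =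
          P (y * z * f * (b * c * d)) / (P (y * (b * c * d)) * P (f * z) * P (y * z) * P (f * (b * c * d)))"
        using cauchy_kernel_balanced[of 0 f z 0 y "b * c * d"] on_circle(1)[OF y z] less1[OF norms(5) bcd(1)]
        by simp
      then show "kernel z (b * c * d) (f * z) y * V\<^sub>3 z =
          P (b * c * d * f) * (cauchy_kernel 0 f z (b * c * d) 0 y * V\<^sub>2 z)"
        using nz[OF less1[OF norms(5) bcd(1)]] by (simp add: kernel_def V\<^sub>3_def mult_ac)
    qed
    also have "\<dots> = P (b * c * d * f) * (K\<^sub>2 * cauchy_kernel 0 f c d 0 y)"
      unfolding circle_mean_cmult
      by (subst circle_mean_cauchy_kernel[OF cont\<^sub>2 _ bcd(2) _ _ _ _ base\<^sub>2]) (use norms y in auto)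
    also have "cauchy_kernel 0 f c d 0 y =
        P (y * c * f * d) / (P (y * d) * P (f * c) * P (y * c) * P (f * d))"
      using cauchy_kernel_balanced[of 0 f c 0 y d] less1[OF y norms(3)] less1[OF norms(5,4)] by simp
    also have "P (b * c * d * f) * (K\<^sub>2 * \<dots>) = K\<^sub>3 * kernel c d (c * f) y"
      by (simp add: K\<^sub>3_def kernel_def mult_ac)
    finally show ?thesis .
  qed

  have final: "circle_mean (\<lambda>z. cauchy_kernel g h z (b * c * d) (f * z) a * V\<^sub>3 z) =
      K\<^sub>3 * cauchy_kernel g h c d (c * f) a"
    by (rule circle_mean_cauchy_kernel[OF cont\<^sub>3 _ bcd(2) _ _ _ _ base\<^sub>3])
       (use norms in \<open>auto intro!: continuous_intros\<close>)

  have nz_abcd: "P (a * (b * c * d)) \<noteq> 0" by (intro nz less1 norms)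
  have integrand: "(let e = exp (\<i> * of_real \<theta>); e' = exp (- \<i> * of_real \<theta>) in
            qpochs_inf [\<rho> * e / d, q * d * e' / \<rho>, \<rho> * c * e', q * e / (c * \<rho>),
                        a * b * c * d * f * e, g * h * e] q
            / qpochs_inf [a * e, b * e, f * e, h * e, c * e', d * e'] q
            * phi32 g (a * e) (f * e) (g * h * e) (a * b * c * d * f * e) q (b * c * d * h)) =
      P (a * (b * c * d)) *
        (cauchy_kernel g h (cis \<theta>) (b * c * d) (f * cis \<theta>) a * V\<^sub>3 (cis \<theta>))"
    if \<theta>: "\<theta> \<in> {-pi..pi}" for \<theta>
  proof -
    define z where "z = cis \<theta>"
    have z: "norm z = 1" by (simp add: z_def)
    have e: "exp (\<i> * of_real \<theta>) = z" by (simp add: z_def cis_conv_exp)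
    have e': "exp (- \<i> * of_real \<theta>) = 1 / z"
      by (simp add: z_def cis_conv_exp exp_minus divide_inverse)
    have ghz: "g * h * z * q ^ k \<noteq> 1" for k using denom_left[OF \<theta>, of k] unfolding e .
    have args: "a * (b * c * d) * (f * z) = a * b * c * d * f * z" "h * (b * c * d) = b * c * d * h" by simp_all
    have "norm (a * (b * c * d) * (f * z)) < 1" by (intro less1 norms on_circle z)
    then have "cauchy_kernel g h z (b * c * d) (f * z) a =
        P (a * b * c * d * f * z) * P (g * h * z) / (P (a * z) * P (a * (b * c * d)) * P (h * z)) *
        phi32 g (a * z) (f * z) (g * h * z) (a * b * c * d * f * z) q (b * c * d * h)"
      using cauchy_kernel_eq_phi32[of a h z "b * c * d" "f * z" g] norms z bcd ghz unfolding args by simp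
    then show ?thesis
      unfolding Let_def e e' z_def[symmetric] using nz_abcd
      by (simp add: qpochs_inf_def V\<^sub>1_def V\<^sub>2_def V\<^sub>3_def mult_ac)
  qed
  have "1 / (2 * of_real pi) *
       integral {-pi..pi} (\<lambda>\<theta>.
         (let e = exp (\<i> * of_real \<theta>); e' = exp (- \<i> * of_real \<theta>) in
            qpochs_inf [\<rho> * e / d, q * d * e' / \<rho>, \<rho> * c * e', q * e / (c * \<rho>),
                        a * b * c * d * f * e, g * h * e] q
            / qpochs_inf [a * e, b * e, f * e, h * e, c * e', d * e'] q
            * phi32 g (a * e) (f * e) (g * h * e) (a * b * c * d * f * e) q (b * c * d * h)))
     = circle_mean (\<lambda>z. P (a * (b * c * d)) * (cauchy_kernel g h z (b * c * d) (f * z) a * V\<^sub>3 z))"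
    unfolding circle_mean_def by (intro arg_cong2[where f = "(*)"] refl integral_cong integrand)
  also have "\<dots> = P (a * (b * c * d)) * (K\<^sub>3 * cauchy_kernel g h c d (c * f) a)"
    unfolding circle_mean_cmult final ..
  also have "cauchy_kernel g h c d (c * f) a =
      P (a * c * d * f) * P (c * g * h) / (P (a * c) * P (a * d) * P (c * h)) *
      phi32 g (a * c) (c * f) (c * g * h) (a * c * d * f) q (d * h)"
  proof -
    have args: "a * d * (c * f) = a * c * d * f" "g * h * c = c * g * h" "h * d = d * h" "h * c = c * h"
      by simp_all
    have "norm (a * d * (c * f)) < 1" by (intro less1 norms)
    then show ?thesis
      using cauchy_kernel_eq_phi32[of a h c d "c * f" g] norms denom_right unfolding args by simp
  qed
  also have "P (a * (b * c * d)) * (K\<^sub>3 * \<dots>) =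
      qpochs_inf [a * b * c * d, \<rho> * c / d, d * q / (\<rho> * c), \<rho>, q / \<rho>,
                   b * c * d * f, a * c * d * f, c * g * h] q
       / qpochs_inf [q, a * c, a * d, b * c, b * d, c * f, c * h, d * f] q
       * phi32 g (a * c) (c * f) (c * g * h) (a * c * d * f) q (d * h)"
    by (simp add: qpochs_inf_def K\<^sub>1_def K\<^sub>2_def K\<^sub>3_def w_def mult_ac)
  finally show ?thesis .
qed

end
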